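(* Let $\mathcal A$ be a triangulated monoidal category acting by triangulated endofunctors on a triangulated category $\mathcal M$. Let $(\mathbf C,\mathbf U)$ be a pair of complementary idempotents in $\mathcal A$, with distinguished triangle $\mathbf C\xrightarrow{\varepsilon}\mathbb 1\xrightarrow{\eta}\mathbf U\xrightarrow{\delta}\mathbf C[1]$, and let $M,N\in\mathcal M$ be arbitrary. Then: (1) $\hom_{\mathcal M}(\mathbf U(M),\mathbf U(N))\cong \hom_{\mathcal M}(M,\mathbf U(N))$; (2) $\hom_{\mathcal M}(\mathbf C(M),\mathbf C(N))\cong \hom_{\mathcal M}(\mathbf C(M),N)$; (3) $\hom_{\mathcal M}(\mathbf C(M),\mathbf U(N))\cong 0$. Moreover, the isomorphism (1) is induced by precomposing with the map $\eta:\mathbb 1\to\mathbf U$ (evaluated at $M$), and the isomorphism (2) is induced by postcomposing with $\varepsilon:\mathbf C\to\mathbb 1$ (evaluated at $N$).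
   Context: A triangulated monoidal category is an additive category $\mathcal A$ equipped with: a triangulated structure (an invertible suspension endofunctor $[1]$ and a class of distinguished triangles satisfying the usual axioms, including Verdier's octahedral axiom); a monoidal structure $(\otimes,\mathbb 1)$ with left unitor $\lambda$; and natural isomorphisms $\alpha_A:A\otimes\mathbb 1[1]\to A[1]$ and $\beta_A:\mathbb 1[1]\otimes A\to A\otimes\mathbb 1[1]$ such that (suppressing associators) $\alpha_{\mathbb 1}=\lambda_{\mathbb 1[1]}$, $\alpha_{A[1]}\circ(\alpha_A\otimes\mathrm{Id}_{\mathbb 1[1]})=\alpha_A[1]\circ\alpha_{A\otimes\mathbb 1[1]}$, $\beta_{\mathbb 1[1]}=-\mathrm{Id}$, and $\beta_{A\otimes B}=(\mathrm{Id}_A\otimes\beta_B)\circ(\beta_A\otimes\mathrm{Id}_B)$. Further, for each distinguished triangle $A\to B\to C\to A[1]$ and each object $D$, the triangles $D\otimes A\to D\otimes B\to D\otimes C\to (D\otimes A)[1]$ and $A\otimes D\to B\otimes D\to C\otimes D\to (A\otimes D)[1]$ are distinguished, where the identifications $D\otimes A[1]\cong(D\otimes A)[1]$ and $A[1]\otimes D\cong(A\otimes D)[1]$ are built from $\alpha,\beta$ and the associator. A pair of complementary idempotents in $\mathcal A$ is a pair of objects $(\mathbf C,\mathbf U)$ with $\mathbf C\otimes\mathbf U\cong 0\cong\mathbf U\otimes\mathbf C$, together with a distinguished triangle $\mathbf C\xrightarrow{\varepsilon}\mathbb 1\xrightarrow{\eta}\mathbf U\xrightarrow{\delta}\mathbf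 C[1]$. $\mathcal A$ acts on $\mathcal M$ by triangulated endofunctors: there is a monoidal action $(A,M)\mapsto A(M)$, so $\mathbb 1(M)\cong M$ and $(A\otimes B)(M)\cong A(B(M))$ naturally and coherently, each $A(-)$ is an exact functor, and evaluating a distinguished triangle of $\mathcal A$ on an object $M\in\mathcal M$ gives a distinguished triangle of $\mathcal M$ (in particular the action is compatible with suspensions). For objects $X,Y$ of a category with suspension, $\hom_{\mathcal M}(X,Y):=\bigoplus_{i\in\mathbb Z}\mathrm{Hom}_{\mathcal M}(X,Y[i])$ is the graded space of homs. *)

theory Defs
  imports "HOL-Algebra.Elementary_Groups" "HOL-Algebra.Product_Groups"
begin

section \<open>Categories\<close>

record ('o, 'a) category =
  Ob  :: "'o set"
  Ar  :: "'a set"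
  Dom :: "'a \<Rightarrow> 'o"
  Cod :: "'a \<Rightarrow> 'o"
  Idn :: "'o \<Rightarrow> 'a"
  Cmp :: "'a \<Rightarrow> 'a \<Rightarrow> 'a"  (infixr "\<cdot>\<index>" 70)

definition Hom :: "('o, 'a, 'x) category_scheme \<Rightarrow> 'o \<Rightarrow> 'o \<Rightarrow> 'a set" where
  "Hom C X Y = {f \<in> Ar C. Dom C f = X \<and> Cod C f = Y}"

text \<open>Composition \<open>g \<cdot> f\<close> (first \<open>f\<close>, then \<open>g\<close>) is only meaningful
  when \<open>Cod f = Dom g\<close>.\<close>

locale category =
  fixes C :: "('o, 'a, 'x) category_scheme" (structure)
  assumes Dom_Ob: "f \<in> Ar C \<Longrightarrow> Dom C f \<in> Ob C"
    and Cod_Ob: "f \<in> Ar C \<Longrightarrow> Cod C f \<in> Ob C"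
    and Idn_Hom: "X \<in> Ob C \<Longrightarrow> Idn C X \<in> Hom C X X"
    and Cmp_Hom: "\<lbrakk>f \<in> Hom C X Y; g \<in> Hom C Y Z\<rbrakk> \<Longrightarrow> g \<cdot> f \<in> Hom C X Z"
    and Cmp_Idn: "f \<in> Hom C X Y \<Longrightarrow> f \<cdot> Idn C X = f"
    and Idn_Cmp: "f \<in> Hom C X Y \<Longrightarrow> Idn C Y \<cdot> f = f"
    and Cmp_assoc: "\<lbrakk>f \<in> Hom C W X; g \<in> Hom C X Y; h \<in> Hom C Y Z\<rbrakk>
      \<Longrightarrow> h \<cdot> (g \<cdot> f) = (h \<cdot> g) \<cdot> f"

definition inverse_arrows :: "('o, 'a, 'x) category_scheme \<Rightarrow> 'a \<Rightarrow> 'a \<Rightarrow> bool" where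
  "inverse_arrows C f g \<longleftrightarrow>
     f \<in> Ar C \<and> g \<in> Hom C (Cod C f) (Dom C f) \<and>
     g \<cdot>\<^bsub>C\<^esub> f = Idn C (Dom C f) \<and> f \<cdot>\<^bsub>C\<^esub> g = Idn C (Cod C f)"

definition iso_arrow :: "('o, 'a, 'x) category_scheme \<Rightarrow> 'a \<Rightarrow> bool" where
  "iso_arrow C f \<longleftrightarrow> (\<exists>g. inverse_arrows C f g)"

definition inv_arrow :: "('o, 'a, 'x) category_scheme \<Rightarrow> 'a \<Rightarrow> 'a" where
  "inv_arrow C f = (THE g. inverse_arrows C f g)"

definition zero_object :: "('o, 'a, 'x) category_scheme \<Rightarrow> 'o \<Rightarrow> bool" where
  "zero_object C Z \<longleftrightarrow> Z \<in> Ob C \<and>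
     (\<forall>X \<in> Ob C. (\<exists>!f. f \<in> Hom C X Z) \<and> (\<exists>!f. f \<in> Hom C Z X))"

definition is_functor ::
  "('o, 'a, 'x) category_scheme \<Rightarrow> ('p, 'b, 'y) category_scheme
    \<Rightarrow> ('o \<Rightarrow> 'p) \<Rightarrow> ('a \<Rightarrow> 'b) \<Rightarrow> bool" where
  "is_functor C D FO FA \<longleftrightarrow>
     (\<forall>X \<in> Ob C. FO X \<in> Ob D) \<and>
     (\<forall>f \<in> Ar C. FA f \<in> Hom D (FO (Dom C f)) (FO (Cod C f))) \<and>
     (\<forall>X \<in> Ob C. FA (Idn C X) = Idn D (FO X)) \<and>
     (\<forall>f \<in> Ar C. \<forall>g \<in> Ar C. Cod C f = Dom C g \<longrightarrow> FA (g \<cdot>\<^bsub>C\<^esub> f) = FA g \<cdot>\<^bsub>D\<^esub> FA f)"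

definition natural_iso ::
  "('o, 'a, 'x) category_scheme \<Rightarrow> ('p, 'b, 'y) category_scheme
    \<Rightarrow> ('o \<Rightarrow> 'p) \<Rightarrow> ('a \<Rightarrow> 'b) \<Rightarrow> ('o \<Rightarrow> 'p) \<Rightarrow> ('a \<Rightarrow> 'b) \<Rightarrow> ('o \<Rightarrow> 'b) \<Rightarrow> bool" where
  "natural_iso C D FO FA GO GA t \<longleftrightarrow>
     (\<forall>X \<in> Ob C. t X \<in> Hom D (FO X) (GO X) \<and> iso_arrow D (t X)) \<and>
     (\<forall>f \<in> Ar C. t (Cod C f) \<cdot>\<^bsub>D\<^esub> FA f = GA f \<cdot>\<^bsub>D\<^esub> t (Dom C f))"

definition prod_cat ::
  "('o, 'a, 'x) category_scheme \<Rightarrow> ('p, 'b, 'y) category_scheme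
    \<Rightarrow> ('o \<times> 'p, 'a \<times> 'b) category" where
  "prod_cat C D =
     \<lparr> Ob = Ob C \<times> Ob D, Ar = Ar C \<times> Ar D,
       Dom = map_prod (Dom C) (Dom D), Cod = map_prod (Cod C) (Cod D),
       Idn = map_prod (Idn C) (Idn D),
       Cmp = (\<lambda>(g, g') (f, f'). (g \<cdot>\<^bsub>C\<^esub> f, g' \<cdot>\<^bsub>D\<^esub> f')) \<rparr>"


section \<open>Additive categories\<close>

record ('o, 'a) add_category = "('o, 'a) category" +
  hadd  :: "'a \<Rightarrow> 'a \<Rightarrow> 'a"
  hzero :: "'o \<Rightarrow> 'o \<Rightarrow> 'a"

text \<open>The abelian group of arrows from \<open>X\<close> to \<open>Y\<close>, in the multiplicative notation of
  \<^theory>\<open>HOL-Algebra.Group\<close>.\<close>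

definition HomG :: "('o, 'a, 'x) add_category_scheme \<Rightarrow> 'o \<Rightarrow> 'o \<Rightarrow> 'a monoid" where
  "HomG C X Y = \<lparr> carrier = Hom C X Y, mult = hadd C, one = hzero C X Y \<rparr>"

definition hneg :: "('o, 'a, 'x) add_category_scheme \<Rightarrow> 'a \<Rightarrow> 'a" where
  "hneg C f = inv\<^bsub>HomG C (Dom C f) (Cod C f)\<^esub> f"

locale additive_category = category C
  for C :: "('o, 'a, 'x) add_category_scheme" (structure) +
  assumes HomG_comm_group: "\<lbrakk>X \<in> Ob C; Y \<in> Ob C\<rbrakk> \<Longrightarrow> comm_group (HomG C X Y)"
    and Cmp_hadd: "\<lbrakk>f \<in> Hom C X Y; f' \<in> Hom C X Y; g \<in> Hom C Y Z\<rbrakk>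
      \<Longrightarrow> g \<cdot> hadd C f f' = hadd C (g \<cdot> f) (g \<cdot> f')"
    and hadd_Cmp: "\<lbrakk>f \<in> Hom C X Y; g \<in> Hom C Y Z; g' \<in> Hom C Y Z\<rbrakk>
      \<Longrightarrow> hadd C g g' \<cdot> f = hadd C (g \<cdot> f) (g' \<cdot> f)"
    and ex_zero_object: "\<exists>Z. zero_object C Z"
    and ex_biproduct: "\<lbrakk>X \<in> Ob C; Y \<in> Ob C\<rbrakk> \<Longrightarrow>
      \<exists>P \<in> Ob C. \<exists>i \<in> Hom C X P. \<exists>j \<in> Hom C Y P. \<exists>p \<in> Hom C P X. \<exists>q \<in> Hom C P Y.
        p \<cdot> i = Idn C X \<and> q \<cdot> j = Idn C Y \<and> q \<cdot> i = hzero C X Y \<and> p \<cdot> j = hzero C Y X \<and>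
        hadd C (i \<cdot> p) (j \<cdot> q) = Idn C P"

definition additive_functor ::
  "('o, 'a, 'x) add_category_scheme \<Rightarrow> ('p, 'b, 'y) add_category_scheme
    \<Rightarrow> ('o \<Rightarrow> 'p) \<Rightarrow> ('a \<Rightarrow> 'b) \<Rightarrow> bool" where
  "additive_functor C D FO FA \<longleftrightarrow> is_functor C D FO FA \<and>
     (\<forall>X \<in> Ob C. \<forall>Y \<in> Ob C. FA \<in> hom (HomG C X Y) (HomG D (FO X) (FO Y)))"


section \<open>Triangulated categories\<close>

text \<open>\<open>shO\<close>, \<open>shA\<close> are the suspension on objects and arrows; a triangle
  \<open>X \<rightarrow> Y \<rightarrow> Z \<rightarrow> X[1]\<close> is represented by its three arrows.\<close>

record ('o, 'a) tri_category = "('o, 'a) add_category" +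
  shO  :: "'o \<Rightarrow> 'o"
  shA  :: "'a \<Rightarrow> 'a"
  dist :: "('a \<times> 'a \<times> 'a) set"

definition triangle ::
  "('o, 'a, 'x) tri_category_scheme \<Rightarrow> 'a \<Rightarrow> 'a \<Rightarrow> 'a \<Rightarrow> bool" where
  "triangle C f g h \<longleftrightarrow> f \<in> Ar C \<and> g \<in> Ar C \<and> h \<in> Ar C \<and>
     Cod C f = Dom C g \<and> Cod C g = Dom C h \<and> Cod C h = shO C (Dom C f)"

locale triangulated_category = additive_category C
  for C :: "('o, 'a, 'x) tri_category_scheme" (structure) +
  assumes sh_functor: "additive_functor C C (shO C) (shA C)"
    and shO_bij: "bij_betw (shO C) (Ob C) (Ob C)"
    and shA_bij: "bij_betw (shA C) (Ar C) (Ar C)"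
    and dist_triangle: "(f, g, h) \<in> dist C \<Longrightarrow> triangle C f g h"
    and dist_iso: "\<lbrakk>(f, g, h) \<in> dist C; triangle C f' g' h';
        u \<in> Hom C (Dom C f) (Dom C f'); v \<in> Hom C (Dom C g) (Dom C g');
        w \<in> Hom C (Dom C h) (Dom C h');
        iso_arrow C u; iso_arrow C v; iso_arrow C w;
        v \<cdot> f = f' \<cdot> u; w \<cdot> g = g' \<cdot> v; shA C u \<cdot> h = h' \<cdot> w\<rbrakk>
      \<Longrightarrow> (f', g', h') \<in> dist C"
    and dist_Idn: "\<lbrakk>X \<in> Ob C; zero_object C Z\<rbrakk>
      \<Longrightarrow> (Idn C X, hzero C X Z, hzero C Z (shO C X)) \<in> dist C"
    and dist_complete: "f \<in> Ar C \<Longrightarrow> \<exists>g h. (f, g, h) \<in> dist C"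
    and dist_rotate: "triangle C f g h
      \<Longrightarrow> (f, g, h) \<in> dist C \<longleftrightarrow> (g, h, hneg C (shA C f)) \<in> dist C"
    and dist_morphism: "\<lbrakk>(f, g, h) \<in> dist C; (f', g', h') \<in> dist C;
        u \<in> Hom C (Dom C f) (Dom C f'); v \<in> Hom C (Dom C g) (Dom C g');
        v \<cdot> f = f' \<cdot> u\<rbrakk>
      \<Longrightarrow> \<exists>w \<in> Hom C (Dom C h) (Dom C h'). w \<cdot> g = g' \<cdot> v \<and> shA C u \<cdot> h = h' \<cdot> w"
    and octahedral: "\<lbrakk>(f, i, j) \<in> dist C; (g, k, l) \<in> dist C; Cod C f = Dom C g;
        (g \<cdot> f, m, n) \<in> dist C\<rbrakk>
      \<Longrightarrow> \<exists>u \<in> Hom C (Cod C i) (Cod C m). \<exists>v \<in> Hom C (Cod C m) (Cod C k).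
            (u, v, shA C i \<cdot> l) \<in> dist C \<and>
            u \<cdot> i = m \<cdot> g \<and> n \<cdot> u = j \<and> v \<cdot> m = k \<and> l \<cdot> v = shA C f \<cdot> n"

text \<open>\<open>\<phi> X : F (X[1]) \<rightarrow> (F X)[1]\<close> is part of the datum of an exact functor.\<close>

definition exact_functor ::
  "('o, 'a, 'x) tri_category_scheme \<Rightarrow> ('p, 'b, 'y) tri_category_scheme
    \<Rightarrow> ('o \<Rightarrow> 'p) \<Rightarrow> ('a \<Rightarrow> 'b) \<Rightarrow> ('o \<Rightarrow> 'b) \<Rightarrow> bool" where
  "exact_functor C D FO FA \<phi> \<longleftrightarrow>
     additive_functor C D FO FA \<and>
     natural_iso C D (\<lambda>X. FO (shO C X)) (\<lambda>f. FA (shA C f))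
       (\<lambda>X. shO D (FO X)) (\<lambda>f. shA D (FA f)) \<phi> \<and>
     (\<forall>f g h. (f, g, h) \<in> dist C \<longrightarrow> (FA f, FA g, \<phi> (Dom C f) \<cdot>\<^bsub>D\<^esub> FA h) \<in> dist D)"

text \<open>The iterated suspensions \<open>X[i]\<close> and \<open>f[i]\<close>, \<open>i\<close> an integer; the suspension is an
  automorphism, so its inverse is taken on the nose.\<close>

definition shOp :: "('o, 'a, 'x) tri_category_scheme \<Rightarrow> int \<Rightarrow> 'o \<Rightarrow> 'o" where
  "shOp C i = (if 0 \<le> i then shO C ^^ nat i else inv_into (Ob C) (shO C) ^^ nat (- i))"

definition shAp :: "('o, 'a, 'x) tri_category_scheme \<Rightarrow> int \<Rightarrow> 'a \<Rightarrow> 'a" where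
  "shAp C i = (if 0 \<le> i then shA C ^^ nat i else inv_into (Ar C) (shA C) ^^ nat (- i))"

definition grHom ::
  "('o, 'a, 'x) tri_category_scheme \<Rightarrow> 'o \<Rightarrow> 'o \<Rightarrow> (int \<Rightarrow> 'a) monoid" where
  "grHom C X Y = sum_group (UNIV :: int set) (\<lambda>i. HomG C X (shOp C i Y))"

definition gr_precomp ::
  "('o, 'a, 'x) tri_category_scheme \<Rightarrow> 'a \<Rightarrow> (int \<Rightarrow> 'a) \<Rightarrow> (int \<Rightarrow> 'a)" where
  "gr_precomp C f \<phi> = (\<lambda>i. \<phi> i \<cdot>\<^bsub>C\<^esub> f)"

definition gr_postcomp ::
  "('o, 'a, 'x) tri_category_scheme \<Rightarrow> 'a \<Rightarrow> (int \<Rightarrow> 'a) \<Rightarrow> (int \<Rightarrow> 'a)" where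
  "gr_postcomp C f \<phi> = (\<lambda>i. shAp C i f \<cdot>\<^bsub>C\<^esub> \<phi> i)"


section \<open>Triangulated monoidal categories\<close>

record ('o, 'a) tm_category = "('o, 'a) tri_category" +
  tenO  :: "'o \<Rightarrow> 'o \<Rightarrow> 'o"  (infixr "\<boxtimes>\<index>" 75)
  tenA  :: "'a \<Rightarrow> 'a \<Rightarrow> 'a"  (infixr "\<boxdot>\<index>" 75)
  unit  :: "'o"
  asc   :: "'o \<Rightarrow> 'o \<Rightarrow> 'o \<Rightarrow> 'a"
  lun   :: "'o \<Rightarrow> 'a"
  run   :: "'o \<Rightarrow> 'a"
  alpha :: "'o \<Rightarrow> 'a"
  beta  :: "'o \<Rightarrow> 'a"

text \<open>\<open>asc A B D : (A \<otimes> B) \<otimes> D \<rightarrow> A \<otimes> (B \<otimes> D)\<close>,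
  \<open>lun A : \<one> \<otimes> A \<rightarrow> A\<close>, \<open>run A : A \<otimes> \<one> \<rightarrow> A\<close>.\<close>

locale monoidal_category = category C
  for C :: "('o, 'a, 'x) tm_category_scheme" (structure) +
  assumes ten_functor:
      "is_functor (prod_cat C C) C (\<lambda>(A, B). A \<boxtimes> B) (\<lambda>(f, g). f \<boxdot> g)"
    and unit_Ob: "unit C \<in> Ob C"
    and asc_natural: "natural_iso (prod_cat C (prod_cat C C)) C
        (\<lambda>(A, B, D). (A \<boxtimes> B) \<boxtimes> D) (\<lambda>(f, g, h). (f \<boxdot> g) \<boxdot> h)
        (\<lambda>(A, B, D). A \<boxtimes> (B \<boxtimes> D)) (\<lambda>(f, g, h). f \<boxdot> (g \<boxdot> h))
        (\<lambda>(A, B, D). asc C A B D)"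
    and lun_natural: "natural_iso C C
        (\<lambda>A. unit C \<boxtimes> A) (\<lambda>f. Idn C (unit C) \<boxdot> f) (\<lambda>A. A) (\<lambda>f. f) (lun C)"
    and run_natural: "natural_iso C C
        (\<lambda>A. A \<boxtimes> unit C) (\<lambda>f. f \<boxdot> Idn C (unit C)) (\<lambda>A. A) (\<lambda>f. f) (run C)"
    and pentagon: "\<lbrakk>A \<in> Ob C; B \<in> Ob C; D \<in> Ob C; E \<in> Ob C\<rbrakk> \<Longrightarrow>
        (Idn C A \<boxdot> asc C B D E) \<cdot> asc C A (B \<boxtimes> D) E \<cdot> (asc C A B D \<boxdot> Idn C E)
          = asc C A B (D \<boxtimes> E) \<cdot> asc C (A \<boxtimes> B) D E"
    and unit_triangle: "\<lbrakk>A \<in> Ob C; B \<in> Ob C\<rbrakk> \<Longrightarrow>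
        (Idn C A \<boxdot> lun C B) \<cdot> asc C A (unit C) B = run C A \<boxdot> Idn C B"

abbreviation sunit :: "('o, 'a, 'x) tm_category_scheme \<Rightarrow> 'o" where
  "sunit C \<equiv> shO C (unit C)"

text \<open>The identifications \<open>D \<otimes> A[1] \<rightarrow> (D \<otimes> A)[1]\<close> and
  \<open>A[1] \<otimes> D \<rightarrow> (A \<otimes> D)[1]\<close>.\<close>

definition sh_right :: "('o, 'a, 'x) tm_category_scheme \<Rightarrow> 'o \<Rightarrow> 'o \<Rightarrow> 'a" where
  "sh_right C D A =
     alpha C (D \<boxtimes>\<^bsub>C\<^esub> A) \<cdot>\<^bsub>C\<^esub> inv_arrow C (asc C D A (sunit C))
       \<cdot>\<^bsub>C\<^esub> inv_arrow C (Idn C D \<boxdot>\<^bsub>C\<^esub> alpha C A)"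

definition sh_left :: "('o, 'a, 'x) tm_category_scheme \<Rightarrow> 'o \<Rightarrow> 'o \<Rightarrow> 'a" where
  "sh_left C A D =
     alpha C (A \<boxtimes>\<^bsub>C\<^esub> D) \<cdot>\<^bsub>C\<^esub> inv_arrow C (asc C A D (sunit C))
       \<cdot>\<^bsub>C\<^esub> (Idn C A \<boxdot>\<^bsub>C\<^esub> beta C D) \<cdot>\<^bsub>C\<^esub> asc C A (sunit C) D
       \<cdot>\<^bsub>C\<^esub> inv_arrow C (alpha C A \<boxdot>\<^bsub>C\<^esub> Idn C D)"

locale triangulated_monoidal_category =
  triangulated_category C + monoidal_category C
  for C :: "('o, 'a, 'x) tm_category_scheme" (structure) +
  assumes alpha_natural: "natural_iso C C
        (\<lambda>A. A \<boxtimes> sunit C) (\<lambda>f. f \<boxdot> Idn C (sunit C)) (shO C) (shA C) (alpha C)"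
    and beta_natural: "natural_iso C C
        (\<lambda>A. sunit C \<boxtimes> A) (\<lambda>f. Idn C (sunit C) \<boxdot> f)
        (\<lambda>A. A \<boxtimes> sunit C) (\<lambda>f. f \<boxdot> Idn C (sunit C)) (beta C)"
    and alpha_unit: "alpha C (unit C) = lun C (sunit C)"
    and alpha_shift: "A \<in> Ob C \<Longrightarrow>
        alpha C (shO C A) \<cdot> (alpha C A \<boxdot> Idn C (sunit C))
          = shA C (alpha C A) \<cdot> alpha C (A \<boxtimes> sunit C)"
    and beta_sunit: "beta C (sunit C) = hneg C (Idn C (sunit C \<boxtimes> sunit C))"
    and beta_ten: "\<lbrakk>A \<in> Ob C; B \<in> Ob C\<rbrakk> \<Longrightarrow>
        beta C (A \<boxtimes> B) =
          inv_arrow C (asc C A B (sunit C)) \<cdot> (Idn C A \<boxdot> beta C B) \<cdot> asc C A (sunit C) B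
            \<cdot> (beta C A \<boxdot> Idn C B) \<cdot> inv_arrow C (asc C (sunit C) A B)"
    and dist_ten_left: "\<lbrakk>(f, g, h) \<in> dist C; D \<in> Ob C\<rbrakk> \<Longrightarrow>
        (Idn C D \<boxdot> f, Idn C D \<boxdot> g, sh_right C D (Dom C f) \<cdot> (Idn C D \<boxdot> h)) \<in> dist C"
    and dist_ten_right: "\<lbrakk>(f, g, h) \<in> dist C; D \<in> Ob C\<rbrakk> \<Longrightarrow>
        (f \<boxdot> Idn C D, g \<boxdot> Idn C D, sh_left C (Dom C f) D \<cdot> (h \<boxdot> Idn C D)) \<in> dist C"

definition complementary_idempotents ::
  "('o, 'a, 'x) tm_category_scheme \<Rightarrow> 'o \<Rightarrow> 'o \<Rightarrow> 'a \<Rightarrow> 'a \<Rightarrow> 'a \<Rightarrow> bool" where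
  "complementary_idempotents \<A> C U \<epsilon> \<eta> \<delta> \<longleftrightarrow>
     C \<in> Ob \<A> \<and> U \<in> Ob \<A> \<and>
     zero_object \<A> (C \<boxtimes>\<^bsub>\<A>\<^esub> U) \<and> zero_object \<A> (U \<boxtimes>\<^bsub>\<A>\<^esub> C) \<and>
     \<epsilon> \<in> Hom \<A> C (unit \<A>) \<and> \<eta> \<in> Hom \<A> (unit \<A>) U \<and> \<delta> \<in> Hom \<A> U (shO \<A> C) \<and>
     (\<epsilon>, \<eta>, \<delta>) \<in> dist \<A>"


section \<open>Actions by triangulated endofunctors\<close>

record ('o, 'a, 'p, 'b) action =
  actO  :: "'o \<Rightarrow> 'p \<Rightarrow> 'p"
  actA  :: "'a \<Rightarrow> 'b \<Rightarrow> 'b"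
  act1  :: "'p \<Rightarrow> 'b"
  actm  :: "'o \<Rightarrow> 'o \<Rightarrow> 'p \<Rightarrow> 'b"
  actsM :: "'o \<Rightarrow> 'p \<Rightarrow> 'b"
  actsA :: "'o \<Rightarrow> 'p \<Rightarrow> 'b"

text \<open>\<open>act1 M : \<one>(M) \<rightarrow> M\<close>, \<open>actm A B M : (A \<otimes> B)(M) \<rightarrow> A(B(M))\<close>,
  \<open>actsM A M : A(M[1]) \<rightarrow> A(M)[1]\<close>, \<open>actsA A M : (A[1])(M) \<rightarrow> A(M)[1]\<close>.\<close>

locale triangulated_action =
  A: triangulated_monoidal_category \<A> + M: triangulated_category \<M>
  for \<A> :: "('o, 'a, 'x) tm_category_scheme"
    and \<M> :: "('p, 'b, 'y) tri_category_scheme"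
    and \<Phi> :: "('o, 'a, 'p, 'b, 'z) action_scheme" +
  assumes act_functor: "is_functor (prod_cat \<A> \<M>) \<M>
        (\<lambda>(A, M). actO \<Phi> A M) (\<lambda>(f, m). actA \<Phi> f m)"
    and act1_natural: "natural_iso \<M> \<M>
        (actO \<Phi> (unit \<A>)) (actA \<Phi> (Idn \<A> (unit \<A>))) (\<lambda>M. M) (\<lambda>m. m) (act1 \<Phi>)"
    and actm_natural: "natural_iso (prod_cat \<A> (prod_cat \<A> \<M>)) \<M>
        (\<lambda>(A, B, M). actO \<Phi> (A \<boxtimes>\<^bsub>\<A>\<^esub> B) M) (\<lambda>(f, g, m). actA \<Phi> (f \<boxdot>\<^bsub>\<A>\<^esub> g) m)
        (\<lambda>(A, B, M). actO \<Phi> A (actO \<Phi> B M)) (\<lambda>(f, g, m). actA \<Phi> f (actA \<Phi> g m))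
        (\<lambda>(A, B, M). actm \<Phi> A B M)"
    and act_pentagon: "\<lbrakk>A \<in> Ob \<A>; B \<in> Ob \<A>; D \<in> Ob \<A>; M \<in> Ob \<M>\<rbrakk> \<Longrightarrow>
        actA \<Phi> (Idn \<A> A) (actm \<Phi> B D M) \<cdot>\<^bsub>\<M>\<^esub> actm \<Phi> A (B \<boxtimes>\<^bsub>\<A>\<^esub> D) M
            \<cdot>\<^bsub>\<M>\<^esub> actA \<Phi> (asc \<A> A B D) (Idn \<M> M)
          = actm \<Phi> A B (actO \<Phi> D M) \<cdot>\<^bsub>\<M>\<^esub> actm \<Phi> (A \<boxtimes>\<^bsub>\<A>\<^esub> B) D M"
    and act_unit_right: "\<lbrakk>A \<in> Ob \<A>; M \<in> Ob \<M>\<rbrakk> \<Longrightarrow>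
        actA \<Phi> (Idn \<A> A) (act1 \<Phi> M) \<cdot>\<^bsub>\<M>\<^esub> actm \<Phi> A (unit \<A>) M
          = actA \<Phi> (run \<A> A) (Idn \<M> M)"
    and act_unit_left: "\<lbrakk>A \<in> Ob \<A>; M \<in> Ob \<M>\<rbrakk> \<Longrightarrow>
        act1 \<Phi> (actO \<Phi> A M) \<cdot>\<^bsub>\<M>\<^esub> actm \<Phi> (unit \<A>) A M
          = actA \<Phi> (lun \<A> A) (Idn \<M> M)"
    and act_exact: "A \<in> Ob \<A> \<Longrightarrow>
        exact_functor \<M> \<M> (actO \<Phi> A) (actA \<Phi> (Idn \<A> A)) (actsM \<Phi> A)"
    and eval_exact: "M \<in> Ob \<M> \<Longrightarrow>
        exact_functor \<A> \<M> (\<lambda>A. actO \<Phi> A M) (\<lambda>f. actA \<Phi> f (Idn \<M> M)) (\<lambda>A. actsA \<Phi> A M)"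

text \<open>An arrow out of, respectively into, \<open>\<one>\<close> evaluated at \<open>M\<close>, using \<open>\<one>(M) \<cong> M\<close>:
  \<open>\<eta> : \<one> \<rightarrow> U\<close> gives \<open>M \<rightarrow> U(M)\<close>, and \<open>\<epsilon> : C \<rightarrow> \<one>\<close> gives \<open>C(M) \<rightarrow> M\<close>.\<close>

definition eval_from_unit ::
  "('p, 'b, 'y) tri_category_scheme \<Rightarrow> ('o, 'a, 'p, 'b, 'z) action_scheme
    \<Rightarrow> 'a \<Rightarrow> 'p \<Rightarrow> 'b" where
  "eval_from_unit \<M> \<Phi> \<eta> M = actA \<Phi> \<eta> (Idn \<M> M) \<cdot>\<^bsub>\<M>\<^esub> inv_arrow \<M> (act1 \<Phi> M)"

definition eval_to_unit ::
  "('p, 'b, 'y) tri_category_scheme \<Rightarrow> ('o, 'a, 'p, 'b, 'z) action_scheme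
    \<Rightarrow> 'a \<Rightarrow> 'p \<Rightarrow> 'b" where
  "eval_to_unit \<M> \<Phi> \<epsilon> M = act1 \<Phi> M \<cdot>\<^bsub>\<M>\<^esub> actA \<Phi> \<epsilon> (Idn \<M> M)"

end

theory Submission
  imports Defs
begin

text \<open>The heart of the matter is \<open>Hom(C(P), U(Q)) = 0\<close> for all \<open>P\<close> and \<open>Q\<close>, which follows from
  the naturality of \<open>\<eta>\<close> and \<open>U(C(P)) = 0 = C(U(Q))\<close>. Since \<open>A(P[1]) \<cong> A(P)[1]\<close> and \<open>P\<close> is
  arbitrary, this vanishing is inherited by all suspensions of the target. The isomorphisms then
  come from the exactness of \<open>Hom\<close> on the triangle \<open>C(P) \<rightarrow> P \<rightarrow> U(P) \<rightarrow> C(P)[1]\<close>: for (1) in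
  each degree, and for (2) in degree \<open>0\<close> for all \<open>P\<close> simultaneously, from where it too is carried
  to all degrees by suspension.\<close>

section \<open>Isomorphisms in a category\<close>

context category
begin

lemma HomD:
  assumes "f \<in> Hom C X Y"
  shows "f \<in> Ar C" "Dom C f = X" "Cod C f = Y" "X \<in> Ob C" "Y \<in> Ob C"
  using assms Dom_Ob Cod_Ob unfolding Hom_def by auto

lemma ArHom: "f \<in> Ar C \<Longrightarrow> f \<in> Hom C (Dom C f) (Cod C f)"
  unfolding Hom_def by auto

text \<open>\<open>inv_arrow\<close> is defined by a description operator, so it denotes an inverse
  only once inverses are known to be unique.\<close>

lemma inverse_arrows_unique:
  assumes "inverse_arrows C f g" "inverse_arrows C f h"
  shows "g = h"
proof -
  have f: "f \<in> Hom C (Dom C f) (Cod C f)" and g: "g \<in> Hom C (Cod C f) (Dom C f)"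
    and h: "h \<in> Hom C (Cod C f) (Dom C f)"
    using assms unfolding inverse_arrows_def Hom_def by auto
  have "g = g \<cdot> (f \<cdot> h)"
    using assms Cmp_Idn[OF g] unfolding inverse_arrows_def by simp
  also have "\<dots> = (g \<cdot> f) \<cdot> h"
    by (rule Cmp_assoc[OF h f g])
  also have "\<dots> = h"
    using assms Idn_Cmp[OF h] unfolding inverse_arrows_def by simp
  finally show ?thesis .
qed

lemma inv_arrow:
  assumes "f \<in> Hom C X Y" "iso_arrow C f"
  shows "inv_arrow C f \<in> Hom C Y X" "inv_arrow C f \<cdot> f = Idn C X" "f \<cdot> inv_arrow C f = Idn C Y"
proof -
  have "inverse_arrows C f (inv_arrow C f)"
    using assms(2) inverse_arrows_unique unfolding iso_arrow_def inv_arrow_def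
    by (metis the_equality)
  then show "inv_arrow C f \<in> Hom C Y X" "inv_arrow C f \<cdot> f = Idn C X"
    "f \<cdot> inv_arrow C f = Idn C Y"
    using HomD[OF assms(1)] unfolding inverse_arrows_def by auto
qed

lemma precomp_iso_bij:
  assumes f: "f \<in> Hom C X Y" "iso_arrow C f"
  shows "bij_betw (\<lambda>g. g \<cdot> f) (Hom C Y Z) (Hom C X Z)"
proof (rule bij_betw_byWitness[where f' = "\<lambda>g. g \<cdot> inv_arrow C f"])
  note i = inv_arrow[OF f]
  show "\<forall>g \<in> Hom C Y Z. (g \<cdot> f) \<cdot> inv_arrow C f = g"
    using Cmp_assoc[OF i(1) f(1)] i(3) Cmp_Idn by metis
  show "\<forall>g \<in> Hom C X Z. (g \<cdot> inv_arrow C f) \<cdot> f = g"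
    using Cmp_assoc[OF f(1) i(1)] i(2) Cmp_Idn by metis
  show "(\<lambda>g. g \<cdot> f) ` Hom C Y Z \<subseteq> Hom C X Z"
    using Cmp_Hom[OF f(1)] by blast
  show "(\<lambda>g. g \<cdot> inv_arrow C f) ` Hom C X Z \<subseteq> Hom C Y Z"
    using Cmp_Hom[OF i(1)] by blast
qed

lemma iso_arrow_Idn: "X \<in> Ob C \<Longrightarrow> iso_arrow C (Idn C X)"
  unfolding iso_arrow_def inverse_arrows_def
  using Idn_Hom[of X] HomD[OF Idn_Hom[of X]] Cmp_Idn[OF Idn_Hom[of X]] by metis

end

section \<open>Zero arrows, signs and zero objects in an additive category\<close>

context additive_category
begin

lemma carrier_HomG [simp]: "carrier (HomG C X Y) = Hom C X Y"
  by (simp add: HomG_def)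

lemma HomG_group: "\<lbrakk>X \<in> Ob C; Y \<in> Ob C\<rbrakk> \<Longrightarrow> group (HomG C X Y)"
  using HomG_comm_group comm_group.axioms(2) by blast

lemma hzero_Hom: "\<lbrakk>X \<in> Ob C; Y \<in> Ob C\<rbrakk> \<Longrightarrow> hzero C X Y \<in> Hom C X Y"
  using monoid.one_closed[OF group.is_monoid[OF HomG_group, of X Y]] by (simp add: HomG_def)

lemma postcomp_hom:
  assumes "g \<in> Hom C Y Z" "X \<in> Ob C"
  shows "(\<lambda>f. g \<cdot> f) \<in> hom (HomG C X Y) (HomG C X Z)"
  using assms Cmp_hadd Cmp_Hom by (auto simp: hom_def HomG_def)

lemma precomp_hom:
  assumes "f \<in> Hom C X Y" "Z \<in> Ob C"
  shows "(\<lambda>g. g \<cdot> f) \<in> hom (HomG C Y Z) (HomG C X Z)"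
  using assms hadd_Cmp Cmp_Hom by (auto simp: hom_def HomG_def)

lemma Cmp_zero:
  assumes "g \<in> Hom C Y Z" "X \<in> Ob C"
  shows "g \<cdot> hzero C X Y = hzero C X Z"
  using hom_one[OF postcomp_hom[OF assms] HomG_group HomG_group] assms(2) HomD[OF assms(1)]
  by (simp add: HomG_def)

lemma zero_Cmp:
  assumes "f \<in> Hom C X Y" "Z \<in> Ob C"
  shows "hzero C Y Z \<cdot> f = hzero C X Z"
  using hom_one[OF precomp_hom[OF assms] HomG_group HomG_group] assms(2) HomD[OF assms(1)]
  by (simp add: HomG_def)

lemma hneg_Hom:
  assumes "f \<in> Hom C X Y" shows "hneg C f \<in> Hom C X Y"
  using group.inv_closed[OF HomG_group, of X Y f] HomD[OF assms] assms
  by (simp add: hneg_def HomG_def)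

lemma hneg_hneg:
  assumes "f \<in> Hom C X Y" shows "hneg C (hneg C f) = f"
  using group.inv_inv[OF HomG_group, of X Y f] HomD[OF assms] HomD[OF hneg_Hom[OF assms]] assms
  by (simp add: hneg_def HomG_def)

lemma hneg_zero:
  assumes "X \<in> Ob C" "Y \<in> Ob C" shows "hneg C (hzero C X Y) = hzero C X Y"
  using monoid.inv_one[OF group.is_monoid[OF HomG_group[OF assms]]] HomD[OF hzero_Hom[OF assms]]
  by (simp add: hneg_def HomG_def)

lemma Cmp_hneg:
  assumes "f \<in> Hom C X Y" "g \<in> Hom C Y Z"
  shows "g \<cdot> hneg C f = hneg C (g \<cdot> f)"
proof -
  interpret group_hom "HomG C X Y" "HomG C X Z" "\<lambda>f. g \<cdot> f"
    using postcomp_hom[OF assms(2)] HomG_group HomD[OF assms(1)] HomD[OF assms(2)]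
    by (auto simp: group_hom_def group_hom_axioms_def)
  show ?thesis
    using hom_inv[of f] assms HomD[OF assms(1)] HomD[OF Cmp_Hom[OF assms]]
    by (simp add: hneg_def)
qed

lemma hneg_Cmp:
  assumes "f \<in> Hom C X Y" "g \<in> Hom C Y Z"
  shows "hneg C g \<cdot> f = hneg C (g \<cdot> f)"
proof -
  interpret group_hom "HomG C Y Z" "HomG C X Z" "\<lambda>g. g \<cdot> f"
    using precomp_hom[OF assms(1)] HomG_group HomD[OF assms(1)] HomD[OF assms(2)]
    by (auto simp: group_hom_def group_hom_axioms_def)
  show ?thesis
    using hom_inv[of g] assms HomD[OF assms(2)] HomD[OF Cmp_Hom[OF assms]]
    by (simp add: hneg_def)
qed

text \<open>Both arrows lie in the singleton \<open>Hom C Z Z\<close>. This equational form of being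
  a zero object passes along isomorphisms and additive functors, so it is the form used from here
  on.\<close>

lemma Idn_zero_object:
  assumes "zero_object C Z" shows "Idn C Z = hzero C Z Z"
  using assms Idn_Hom hzero_Hom unfolding zero_object_def by blast

lemma Hom_into_zero:
  assumes "Idn C Z = hzero C Z Z" "f \<in> Hom C X Z"
  shows "f = hzero C X Z"
  using Idn_Cmp[OF assms(2)] zero_Cmp[OF assms(2)] HomD[OF assms(2)] assms(1) by metis

lemma Hom_from_zero:
  assumes "Idn C Z = hzero C Z Z" "f \<in> Hom C Z X"
  shows "f = hzero C Z X"
  using Cmp_Idn[OF assms(2)] Cmp_zero[OF assms(2)] HomD[OF assms(2)] assms(1) by metis

lemma zero_objectI:
  assumes "Z \<in> Ob C" "Idn C Z = hzero C Z Z" shows "zero_object C Z"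
  unfolding zero_object_def
  using assms hzero_Hom Hom_into_zero[OF assms(2)] Hom_from_zero[OF assms(2)] by blast

text \<open>The identity of \<open>X\<close> is \<open>f \<cdot> inv_arrow C f\<close>, and
  \<open>f\<close> vanishes as an arrow out of a zero object.\<close>

lemma Idn_zero_iso:
  assumes "Idn C Z = hzero C Z Z" "f \<in> Hom C Z X" "iso_arrow C f"
  shows "Idn C X = hzero C X X"
  using Hom_from_zero[OF assms(1,2)] inv_arrow[OF assms(2,3)] HomD[OF assms(2)] zero_Cmp by metis

lemma zero_Cmp_iso:
  assumes f: "f \<in> Hom C X Y" "iso_arrow C f" and g: "g \<in> Hom C Y Z" "g \<cdot> f = hzero C X Z"
  shows "g = hzero C Y Z"
proof -
  have "g = (g \<cdot> f) \<cdot> inv_arrow C f"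
    using Cmp_assoc[OF inv_arrow(1)[OF f] f(1) g(1)] inv_arrow(3)[OF f] Cmp_Idn[OF g(1)] by simp
  then show ?thesis
    using g(2) zero_Cmp[OF inv_arrow(1)[OF f]] HomD[OF g(1)] by simp
qed

lemma postcomp_iso:
  assumes "g \<in> Hom C Y Z" "X \<in> Ob C" "bij_betw (\<lambda>f. g \<cdot> f) (Hom C X Y) (Hom C X Z)"
  shows "(\<lambda>f. g \<cdot> f) \<in> iso (HomG C X Y) (HomG C X Z)"
  using postcomp_hom[OF assms(1,2)] assms(3) by (simp add: iso_def HomG_def)

lemma precomp_iso:
  assumes "f \<in> Hom C X Y" "Z \<in> Ob C" "bij_betw (\<lambda>g. g \<cdot> f) (Hom C Y Z) (Hom C X Z)"
  shows "(\<lambda>g. g \<cdot> f) \<in> iso (HomG C Y Z) (HomG C X Z)"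
  using precomp_hom[OF assms(1,2)] assms(3) by (simp add: iso_def HomG_def)

text \<open>Composition with a fixed arrow is a group homomorphism, so a trivial kernel suffices;
  exactness arguments yield statements about kernels.\<close>

lemma postcomp_injI:
  assumes g: "g \<in> Hom C Y Z" and X: "X \<in> Ob C"
    and ker: "\<And>f. \<lbrakk>f \<in> Hom C X Y; g \<cdot> f = hzero C X Z\<rbrakk> \<Longrightarrow> f = hzero C X Y"
  shows "inj_on (\<lambda>f. g \<cdot> f) (Hom C X Y)"
proof -
  interpret group_hom "HomG C X Y" "HomG C X Z" "\<lambda>f. g \<cdot> f"
    using postcomp_hom[OF g X] HomG_group HomD[OF g] X
    by (auto simp: group_hom_def group_hom_axioms_def)
  show ?thesis
    using inj_on_one_iff ker by (simp add: HomG_def)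
qed

lemma precomp_injI:
  assumes f: "f \<in> Hom C X Y" and Z: "Z \<in> Ob C"
    and ker: "\<And>g. \<lbrakk>g \<in> Hom C Y Z; g \<cdot> f = hzero C X Z\<rbrakk> \<Longrightarrow> g = hzero C Y Z"
  shows "inj_on (\<lambda>g. g \<cdot> f) (Hom C Y Z)"
proof -
  interpret group_hom "HomG C Y Z" "HomG C X Z" "\<lambda>g. g \<cdot> f"
    using precomp_hom[OF f Z] HomG_group HomD[OF f] Z
    by (auto simp: group_hom_def group_hom_axioms_def)
  show ?thesis
    using inj_on_one_iff ker by (simp add: HomG_def)
qed

end

section \<open>Suspension on hom-sets\<close>

context triangulated_category
begin

lemma shO_Ob: "X \<in> Ob C \<Longrightarrow> shO C X \<in> Ob C"
  using shO_bij bij_betwE by blast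

lemma shA_Hom: "f \<in> Hom C X Y \<Longrightarrow> shA C f \<in> Hom C (shO C X) (shO C Y)"
  using sh_functor unfolding additive_functor_def is_functor_def Hom_def by blast

lemma shA_Cmp:
  assumes "f \<in> Hom C X Y" "g \<in> Hom C Y Z"
  shows "shA C (g \<cdot> f) = shA C g \<cdot> shA C f"
  using sh_functor HomD[OF assms(1)] HomD[OF assms(2)]
  unfolding additive_functor_def is_functor_def by simp

lemma shA_Idn: "X \<in> Ob C \<Longrightarrow> shA C (Idn C X) = Idn C (shO C X)"
  using sh_functor unfolding additive_functor_def is_functor_def by simp

lemma shA_zero:
  assumes "X \<in> Ob C" "Y \<in> Ob C"
  shows "shA C (hzero C X Y) = hzero C (shO C X) (shO C Y)"
proof -
  have "shA C \<in> hom (HomG C X Y) (HomG C (shO C X) (shO C Y))"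
    using sh_functor assms unfolding additive_functor_def by blast
  from hom_one[OF this HomG_group HomG_group] show ?thesis
    using assms shO_Ob by (simp add: HomG_def)
qed

text \<open>The suspension is assumed bijective only on the set of all arrows. A preimage of an
  arrow between suspended objects has the right ends because \<open>shO\<close> is injective on
  objects. So the suspension is fully faithful.\<close>

lemma shA_bij_Hom:
  assumes "X \<in> Ob C" "Y \<in> Ob C"
  shows "bij_betw (shA C) (Hom C X Y) (Hom C (shO C X) (shO C Y))"
proof (rule bij_betw_imageI)
  show "inj_on (shA C) (Hom C X Y)"
    using shA_bij unfolding bij_betw_def by (auto simp: Hom_def intro: inj_on_subset)
  show "shA C ` Hom C X Y = Hom C (shO C X) (shO C Y)"
  proof (intro equalityI subsetI)
    fix g assume g: "g \<in> Hom C (shO C X) (shO C Y)"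
    then obtain f where f: "f \<in> Ar C" "g = shA C f"
      using shA_bij HomD[OF g] unfolding bij_betw_def by blast
    have "shO C (Dom C f) = shO C X" "shO C (Cod C f) = shO C Y"
      using HomD[OF g] HomD[OF shA_Hom[OF ArHom[OF f(1)]]] f(2) by auto
    then have "Dom C f = X" "Cod C f = Y"
      using shO_bij Dom_Ob[OF f(1)] Cod_Ob[OF f(1)] assms
      unfolding bij_betw_def by (auto dest: inj_onD)
    then show "g \<in> shA C ` Hom C X Y"
      using f by (auto simp: Hom_def)
  qed (use shA_Hom in auto)
qed

lemma zero_object_shO:
  assumes "zero_object C Z" shows "zero_object C (shO C Z)"
proof (rule zero_objectI)
  have Z: "Z \<in> Ob C" using assms unfolding zero_object_def by blast
  then show "shO C Z \<in> Ob C" by (rule shO_Ob)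
  show "Idn C (shO C Z) = hzero C (shO C Z) (shO C Z)"
    using shA_Idn[OF Z] shA_zero[OF Z Z] Idn_zero_object[OF assms] by simp
qed

section \<open>Exactness of Hom on distinguished triangles\<close>

lemma dist_Hom:
  assumes "(f, g, h) \<in> dist C" "f \<in> Hom C X Y" "g \<in> Hom C Y Z"
  shows "h \<in> Hom C Z (shO C X)"
  using dist_triangle[OF assms(1)] HomD[OF assms(2)] HomD[OF assms(3)]
  unfolding triangle_def Hom_def by auto

lemma dist_rotateD:
  "(f, g, h) \<in> dist C \<Longrightarrow> (g, h, hneg C (shA C f)) \<in> dist C"
  using dist_rotate dist_triangle by blast

text \<open>Exactness of \<open>Hom(-, W)\<close> at \<open>Y\<close>. Since \<open>u\<close> kills
  \<open>f\<close>, the pair of \<open>0\<close> and \<open>u\<close> starts a morphism from the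
  given triangle to the triangle \<open>0 -> W -> W -> 0[1]\<close>, and its third component is the
  desired factorisation.\<close>

lemma dist_weak_cokernel:
  assumes d: "(f, g, h) \<in> dist C" and f: "f \<in> Hom C X Y" and g: "g \<in> Hom C Y Z"
    and u: "u \<in> Hom C Y W" "u \<cdot> f = hzero C X W"
  shows "\<exists>v \<in> Hom C Z W. v \<cdot> g = u"
proof -
  obtain O' where z: "zero_object C O'" using ex_zero_object by blast
  have O': "O' \<in> Ob C" using z unfolding zero_object_def by blast
  have W: "W \<in> Ob C" and X: "X \<in> Ob C" using HomD[OF u(1)] HomD[OF f] by auto
  note hW = hzero_Hom[OF O' W] and hS = hzero_Hom[OF W shO_Ob[OF O']]
  \<comment> \<open>The triangle on \<open>O' -> W -> W\<close> is found by rotating backwards: its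
    rotation is the identity triangle of \<open>W\<close> formed with the zero object
    \<open>O'[1]\<close>.\<close>
  have "triangle C (hzero C O' W) (Idn C W) (hzero C W (shO C O'))"
    using HomD[OF hW] HomD[OF hS] HomD[OF Idn_Hom[OF W]] by (simp add: triangle_def)
  moreover have "(Idn C W, hzero C W (shO C O'), hneg C (shA C (hzero C O' W))) \<in> dist C"
    using dist_Idn[OF W zero_object_shO[OF z]] shA_zero[OF O' W] hneg_zero shO_Ob O' W by simp
  ultimately have d': "(hzero C O' W, Idn C W, hzero C W (shO C O')) \<in> dist C"
    using dist_rotate by blast
  have h: "h \<in> Hom C Z (shO C X)" by (rule dist_Hom[OF d f g])
  obtain w where "w \<in> Hom C Z W" "w \<cdot> g = Idn C W \<cdot> u"
    using dist_morphism[OF d d', of "hzero C X O'" u] hzero_Hom[OF X O'] u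
      HomD[OF f] HomD[OF g] HomD[OF h] HomD[OF hW] HomD[OF hS] HomD[OF Idn_Hom[OF W]]
      Cmp_zero[OF hW X] by auto
  then show ?thesis using Idn_Cmp[OF u(1)] by auto
qed

text \<open>Exactness of \<open>Hom(W, -)\<close> at \<open>Y\<close>. The axiom on morphisms of
  triangles constructs only a third component, whereas here the first one is wanted. So both the
  given triangle and the identity triangle of \<open>W\<close> are rotated once, and the component
  obtained is desuspended.\<close>

lemma dist_weak_kernel:
  assumes d: "(f, g, h) \<in> dist C" and f: "f \<in> Hom C X Y" and g: "g \<in> Hom C Y Z"
    and u: "u \<in> Hom C W Y" "g \<cdot> u = hzero C W Z"
  shows "\<exists>v \<in> Hom C W X. f \<cdot> v = u"
proof -
  obtain O' where z: "zero_object C O'" using ex_zero_object by blast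
  have O': "O' \<in> Ob C" using z unfolding zero_object_def by blast
  have W: "W \<in> Ob C" and X: "X \<in> Ob C" and Z: "Z \<in> Ob C"
    using HomD[OF u(1)] HomD[OF f] HomD[OF g] by auto
  note hW = hzero_Hom[OF W O'] and hS = hzero_Hom[OF O' shO_Ob[OF W]]
  have h: "h \<in> Hom C Z (shO C X)" by (rule dist_Hom[OF d f g])
  have nf: "hneg C (shA C f) \<in> Hom C (shO C X) (shO C Y)"
    by (intro hneg_Hom shA_Hom f)
  have nI: "hneg C (shA C (Idn C W)) \<in> Hom C (shO C W) (shO C W)"
    by (intro hneg_Hom shA_Hom Idn_Hom W)
  \<comment> \<open>The morphism goes from \<open>W -> O' -> W[1] -> W[1]\<close> to
    \<open>Y -> Z -> X[1] -> Y[1]\<close> and starts with \<open>u\<close> and \<open>0\<close>; its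
    first square commutes because \<open>g \<cdot> u\<close> is zero.\<close>
  obtain w where w: "w \<in> Hom C (shO C W) (shO C X)"
    "shA C u \<cdot> hneg C (shA C (Idn C W)) = hneg C (shA C f) \<cdot> w"
    using dist_morphism[OF dist_rotateD[OF dist_Idn[OF W z]] dist_rotateD[OF d], of u "hzero C O' Z"]
      hzero_Hom[OF O' Z] u zero_Cmp[OF hW Z]
      HomD[OF f] HomD[OF g] HomD[OF h] HomD[OF hW] HomD[OF hS] HomD[OF nf] HomD[OF nI] by auto
  obtain v where v: "v \<in> Hom C W X" "w = shA C v"
    using shA_bij_Hom[OF W X] w(1) unfolding bij_betw_def by blast
  have su: "shA C u \<in> Hom C (shO C W) (shO C Y)" by (rule shA_Hom[OF u(1)])
  have fv: "f \<cdot> v \<in> Hom C W Y" by (rule Cmp_Hom[OF v(1) f])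
  \<comment> \<open>Each rotation contributes one sign, so the two signs cancel, and faithfulness of
    the suspension removes the shift.\<close>
  have "hneg C (shA C u) = hneg C (shA C (f \<cdot> v))"
    using w(2) Cmp_hneg[OF shA_Hom[OF Idn_Hom[OF W]] su] hneg_Cmp[OF w(1) shA_Hom[OF f]]
      shA_Cmp[OF v(1) f] v(2) shA_Idn[OF W] Cmp_Idn[OF su] by simp
  then have "shA C u = shA C (f \<cdot> v)"
    using hneg_hneg[OF su] hneg_hneg[OF shA_Hom[OF fv]] by metis
  then have "f \<cdot> v = u"
    using shA_bij_Hom[OF W, of Y] HomD[OF f] u(1) fv unfolding bij_betw_def
    by (metis inj_onD)
  then show ?thesis using v(1) by blast
qed

text \<open>Induction over the integers in both directions from degree \<open>0\<close>. Negative
  powers are iterates of the inverse suspension, so the downward step goes from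
  \<open>shA C f\<close> to \<open>f\<close>. Arrows rather than objects carry the property; an
  object is treated through its identity.\<close>

lemma shift_int_induct [consumes 1, case_names zero suspend desuspend]:
  assumes e: "e \<in> Ar C"
    and zero: "P e"
    and suspend: "\<And>f. \<lbrakk>f \<in> Ar C; P f\<rbrakk> \<Longrightarrow> P (shA C f)"
    and desuspend: "\<And>f. \<lbrakk>f \<in> Ar C; P (shA C f)\<rbrakk> \<Longrightarrow> P f"
  shows "P (shAp C i e)"
proof -
  have pos: "(shA C ^^ n) e \<in> Ar C \<and> P ((shA C ^^ n) e)" for n
  proof (induction n)
    case (Suc n)
    then show ?case using suspend shA_bij bij_betwE by fastforce
  qed (use e zero in auto)
  have neg: "(inv_into (Ar C) (shA C) ^^ n) e \<in> Ar C \<and> P ((inv_into (Ar C) (shA C) ^^ n) e)" for n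
  proof (induction n)
    case (Suc n)
    let ?g = "inv_into (Ar C) (shA C) ((inv_into (Ar C) (shA C) ^^ n) e)"
    have "(inv_into (Ar C) (shA C) ^^ n) e \<in> shA C ` Ar C"
      using Suc shA_bij by (simp add: bij_betw_def)
    then have "?g \<in> Ar C" "shA C ?g = (inv_into (Ar C) (shA C) ^^ n) e"
      by (auto intro: inv_into_into f_inv_into_f)
    then show ?case using desuspend Suc by simp
  qed (use e zero in auto)
  show ?thesis using pos neg unfolding shAp_def by simp
qed

text \<open>The ends of the preimage arrow suspend to \<open>X\<close> and \<open>Y\<close>;
  injectivity of \<open>shO\<close> identifies them with the preimages chosen by
  \<open>inv_into\<close>.\<close>

lemma desuspend_Hom:
  assumes f: "f \<in> Hom C X Y"
  shows "inv_into (Ar C) (shA C) f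
    \<in> Hom C (inv_into (Ob C) (shO C) X) (inv_into (Ob C) (shO C) Y)"
proof -
  let ?g = "inv_into (Ar C) (shA C) f"
  have "f \<in> shA C ` Ar C" using shA_bij HomD[OF f] by (simp add: bij_betw_def)
  then have g: "?g \<in> Ar C" "shA C ?g = f" by (auto intro: inv_into_into f_inv_into_f)
  have inj: "inj_on (shO C) (Ob C)" using shO_bij by (simp add: bij_betw_def)
  have "X = shO C (Dom C ?g)" "Y = shO C (Cod C ?g)"
    using HomD[OF shA_Hom[OF ArHom[OF g(1)]]] g(2) HomD[OF f] by auto
  then have "inv_into (Ob C) (shO C) X = Dom C ?g" "inv_into (Ob C) (shO C) Y = Cod C ?g"
    using inv_into_f_f[OF inj] Dom_Ob[OF g(1)] Cod_Ob[OF g(1)] by auto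
  then show ?thesis using g(1) unfolding Hom_def by auto
qed

lemma shAp_Hom:
  assumes "f \<in> Hom C X Y"
  shows "shAp C i f \<in> Hom C (shOp C i X) (shOp C i Y)"
proof -
  have "(shA C ^^ n) f \<in> Hom C ((shO C ^^ n) X) ((shO C ^^ n) Y)" for n
    by (induction n) (use assms shA_Hom in auto)
  moreover have "(inv_into (Ar C) (shA C) ^^ n) f
      \<in> Hom C ((inv_into (Ob C) (shO C) ^^ n) X) ((inv_into (Ob C) (shO C) ^^ n) Y)" for n
    by (induction n) (use assms desuspend_Hom in auto)
  ultimately show ?thesis unfolding shAp_def shOp_def by simp
qed

lemma shOp_Ob: "X \<in> Ob C \<Longrightarrow> shOp C i X \<in> Ob C"
  using HomD(4)[OF shAp_Hom[OF Idn_Hom]] .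

end

section \<open>Componentwise maps between direct sums of groups\<close>

lemma sum_group_map_hom:
  assumes "\<And>i. i \<in> I \<Longrightarrow> group (G i)" "\<And>i. i \<in> I \<Longrightarrow> group (H i)"
    and f: "\<And>i. i \<in> I \<Longrightarrow> f i \<in> hom (G i) (H i)"
  shows "(\<lambda>x. \<lambda>i\<in>I. f i (x i)) \<in> hom (sum_group I G) (sum_group I H)"
proof (rule homI)
  fix x assume x: "x \<in> carrier (sum_group I G)"
  \<comment> \<open>Homomorphisms preserve the neutral element, so the support can only shrink and
    stays finite.\<close>
  have "{i \<in> I. f i (x i) \<noteq> \<one>\<^bsub>H i\<^esub>} \<subseteq> {i \<in> I. x i \<noteq> \<one>\<^bsub>G i\<^esub>}"
    using hom_one[OF f] assms(1,2) by auto
  then have "finite {i \<in> I. f i (x i) \<noteq> \<one>\<^bsub>H i\<^esub>}"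
    using x by (auto simp: carrier_sum_group assms(1) intro: finite_subset)
  moreover have "{i \<in> I. (\<lambda>i\<in>I. f i (x i)) i \<noteq> \<one>\<^bsub>H i\<^esub>} = {i \<in> I. f i (x i) \<noteq> \<one>\<^bsub>H i\<^esub>}"
    by auto
  ultimately show "(\<lambda>i\<in>I. f i (x i)) \<in> carrier (sum_group I H)"
    using x f by (auto simp: carrier_sum_group assms(1,2) PiE_iff hom_def Pi_iff)
next
  fix x y assume "x \<in> carrier (sum_group I G)" "y \<in> carrier (sum_group I G)"
  then show "(\<lambda>i\<in>I. f i ((x \<otimes>\<^bsub>sum_group I G\<^esub> y) i))
      = (\<lambda>i\<in>I. f i (x i)) \<otimes>\<^bsub>sum_group I H\<^esub> (\<lambda>i\<in>I. f i (y i))"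
    using f by (auto simp: carrier_sum_group assms(1) PiE_iff hom_def intro!: restrict_ext)
qed

text \<open>The componentwise inverses are homomorphisms too, so they also preserve finite support
  and assemble to an inverse on the direct sums.\<close>

lemma sum_group_map_iso:
  assumes G: "\<And>i. i \<in> I \<Longrightarrow> group (G i)" and H: "\<And>i. i \<in> I \<Longrightarrow> group (H i)"
    and f: "\<And>i. i \<in> I \<Longrightarrow> f i \<in> iso (G i) (H i)"
  shows "(\<lambda>x. \<lambda>i\<in>I. f i (x i)) \<in> iso (sum_group I G) (sum_group I H)"
proof -
  let ?g = "\<lambda>i. inv_into (carrier (G i)) (f i)"
  have f': "f i \<in> hom (G i) (H i)" "bij_betw (f i) (carrier (G i)) (carrier (H i))" if "i \<in> I" for i
    using f[OF that] by (auto simp: iso_def)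
  have g: "?g i \<in> hom (H i) (G i)" if "i \<in> I" for i
    using group.iso_set_sym[OF G f] that by (auto simp: iso_def)
  note hf = sum_group_map_hom[of I G H f, OF G H f'(1)]
    and hg = sum_group_map_hom[of I H G ?g, OF H G g]
  have "bij_betw (\<lambda>x. \<lambda>i\<in>I. f i (x i)) (carrier (sum_group I G)) (carrier (sum_group I H))"
  proof (rule bij_betw_byWitness[where f' = "\<lambda>x. \<lambda>i\<in>I. ?g i (x i)"])
    show "\<forall>x \<in> carrier (sum_group I G). (\<lambda>i\<in>I. ?g i ((\<lambda>i\<in>I. f i (x i)) i)) = x"
      using bij_betw_inv_into_left[OF f'(2)]
      by (auto simp: carrier_sum_group G PiE_iff extensional_def fun_eq_iff)
    show "\<forall>x \<in> carrier (sum_group I H). (\<lambda>i\<in>I. f i ((\<lambda>i\<in>I. ?g i (x i)) i)) = x"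
      using bij_betw_inv_into_right[OF f'(2)]
      by (auto simp: carrier_sum_group H PiE_iff extensional_def fun_eq_iff)
  qed (use hf hg in \<open>auto simp: hom_def\<close>)
  then show ?thesis using hf by (simp add: iso_def)
qed

lemma sum_group_trivial:
  assumes "\<And>i. i \<in> I \<Longrightarrow> trivial_group (G i)"
  shows "trivial_group (sum_group I G)"
  unfolding trivial_group_def
proof
  have G: "\<And>i. i \<in> I \<Longrightarrow> group (G i)" "\<And>i. i \<in> I \<Longrightarrow> carrier (G i) = {\<one>\<^bsub>G i\<^esub>}"
    using assms by (auto simp: trivial_group_def)
  then show "group (sum_group I G)" by simp
  then show "carrier (sum_group I G) = {\<one>\<^bsub>sum_group I G\<^esub>}"
    using G(2) monoid.one_closed[OF group.is_monoid, of "sum_group I G"]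
    by (auto simp: carrier_sum_group G(1) PiE_iff extensional_def fun_eq_iff)
qed

section \<open>Degreewise criteria for graded hom groups\<close>

context triangulated_category
begin

text \<open>The graded group is a direct sum over all integers, so bijectivity may be tested in each
  degree. Restriction to \<open>UNIV\<close> changes nothing, which makes the assembled map
  literally \<open>gr_precomp\<close>.\<close>

lemma gr_precomp_iso:
  assumes f: "f \<in> Hom C X Y" and Z: "Z \<in> Ob C"
    and bij: "\<And>i. bij_betw (\<lambda>g. g \<cdot> f) (Hom C Y (shOp C i Z)) (Hom C X (shOp C i Z))"
  shows "gr_precomp C f \<in> iso (grHom C Y Z) (grHom C X Z)"
proof -
  have "(\<lambda>\<phi>. \<lambda>i\<in>UNIV. \<phi> i \<cdot> f) \<in> iso (grHom C Y Z) (grHom C X Z)"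
    unfolding grHom_def
    by (rule sum_group_map_iso)
      (use HomG_group HomD[OF f] shOp_Ob[OF Z] precomp_iso[OF f shOp_Ob[OF Z] bij] in auto)
  then show ?thesis by (simp add: gr_precomp_def[abs_def] restrict_def)
qed

lemma gr_postcomp_iso:
  assumes f: "f \<in> Hom C Y Z" and X: "X \<in> Ob C"
    and bij: "\<And>i. bij_betw (\<lambda>g. shAp C i f \<cdot> g) (Hom C X (shOp C i Y)) (Hom C X (shOp C i Z))"
  shows "gr_postcomp C f \<in> iso (grHom C X Y) (grHom C X Z)"
proof -
  have "(\<lambda>\<phi>. \<lambda>i\<in>UNIV. shAp C i f \<cdot> \<phi> i) \<in> iso (grHom C X Y) (grHom C X Z)"
    unfolding grHom_def
    by (rule sum_group_map_iso)
      (use HomG_group HomD[OF f] shOp_Ob X postcomp_iso[OF shAp_Hom[OF f] X bij] in auto)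
  then show ?thesis by (simp add: gr_postcomp_def[abs_def] restrict_def)
qed

lemma grHom_trivial:
  assumes "X \<in> Ob C" "Y \<in> Ob C"
    and zero: "\<And>i f. f \<in> Hom C X (shOp C i Y) \<Longrightarrow> f = hzero C X (shOp C i Y)"
  shows "trivial_group (grHom C X Y)"
  unfolding grHom_def
proof (rule sum_group_trivial)
  fix i
  have "Hom C X (shOp C i Y) = {hzero C X (shOp C i Y)}"
    using zero hzero_Hom[OF assms(1) shOp_Ob[OF assms(2)]] by blast
  then show "trivial_group (HomG C X (shOp C i Y))"
    using HomG_group[OF assms(1) shOp_Ob[OF assms(2)]]
    by (simp add: trivial_group_def) (simp add: HomG_def)
qed

end

section \<open>Evaluating objects, arrows and triangles of the monoidal category\<close>

context triangulated_action
begin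

lemma act_Ob: "\<lbrakk>X \<in> Ob \<A>; P \<in> Ob \<M>\<rbrakk> \<Longrightarrow> actO \<Phi> X P \<in> Ob \<M>"
  using act_functor by (auto simp: is_functor_def prod_cat_def)

lemma act_Hom:
  "\<lbrakk>f \<in> Hom \<A> X Y; m \<in> Hom \<M> P Q\<rbrakk> \<Longrightarrow> actA \<Phi> f m \<in> Hom \<M> (actO \<Phi> X P) (actO \<Phi> Y Q)"
  using act_functor by (auto simp: is_functor_def prod_cat_def Hom_def)

lemma act_Idn:
  "\<lbrakk>X \<in> Ob \<A>; P \<in> Ob \<M>\<rbrakk> \<Longrightarrow> actA \<Phi> (Idn \<A> X) (Idn \<M> P) = Idn \<M> (actO \<Phi> X P)"
  using act_functor by (auto simp: is_functor_def prod_cat_def)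

lemma act_Cmp:
  "\<lbrakk>f \<in> Hom \<A> X Y; g \<in> Hom \<A> Y Z; m \<in> Hom \<M> P Q; n \<in> Hom \<M> Q R\<rbrakk>
    \<Longrightarrow> actA \<Phi> (g \<cdot>\<^bsub>\<A>\<^esub> f) (n \<cdot>\<^bsub>\<M>\<^esub> m) = actA \<Phi> g n \<cdot>\<^bsub>\<M>\<^esub> actA \<Phi> f m"
  using act_functor by (auto simp: is_functor_def prod_cat_def Hom_def)

text \<open>By bifunctoriality both composites equal \<open>actA \<Phi> f m\<close>. This is the
  naturality of the action of \<open>f\<close>.\<close>

lemma act_interchange:
  assumes f: "f \<in> Hom \<A> X Y" and m: "m \<in> Hom \<M> P Q"
  shows "actA \<Phi> f (Idn \<M> Q) \<cdot>\<^bsub>\<M>\<^esub> actA \<Phi> (Idn \<A> X) m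
    = actA \<Phi> (Idn \<A> Y) m \<cdot>\<^bsub>\<M>\<^esub> actA \<Phi> f (Idn \<M> P)"
  using act_Cmp[OF A.Idn_Hom f m M.Idn_Hom] act_Cmp[OF f A.Idn_Hom M.Idn_Hom m]
    A.HomD[OF f] M.HomD[OF m] A.Cmp_Idn[OF f] A.Idn_Cmp[OF f] M.Cmp_Idn[OF m] M.Idn_Cmp[OF m]
  by simp

lemma act1_iso:
  assumes "P \<in> Ob \<M>"
  shows "act1 \<Phi> P \<in> Hom \<M> (actO \<Phi> (unit \<A>) P) P" "iso_arrow \<M> (act1 \<Phi> P)"
  using act1_natural assms by (auto simp: natural_iso_def)

lemma actsM_iso:
  assumes "X \<in> Ob \<A>" "P \<in> Ob \<M>"
  shows "actsM \<Phi> X P \<in> Hom \<M> (actO \<Phi> X (shO \<M> P)) (shO \<M> (actO \<Phi> X P))"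
    "iso_arrow \<M> (actsM \<Phi> X P)"
  using act_exact[OF assms(1)] assms(2) by (auto simp: exact_functor_def natural_iso_def)

lemma actm_iso:
  assumes "X \<in> Ob \<A>" "Y \<in> Ob \<A>" "P \<in> Ob \<M>"
  shows "actm \<Phi> X Y P \<in> Hom \<M> (actO \<Phi> (X \<boxtimes>\<^bsub>\<A>\<^esub> Y) P) (actO \<Phi> X (actO \<Phi> Y P))"
    "iso_arrow \<M> (actm \<Phi> X Y P)"
  using actm_natural assms by (auto simp: natural_iso_def prod_cat_def)

text \<open>Evaluation at \<open>P\<close> is an additive functor, so it carries the equation
  between the identity and the zero arrow of \<open>Z\<close> to the same equation for
  \<open>Z(P)\<close>.\<close>

lemma act_zero_object:
  assumes Z: "zero_object \<A> Z" and P: "P \<in> Ob \<M>"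
  shows "Idn \<M> (actO \<Phi> Z P) = hzero \<M> (actO \<Phi> Z P) (actO \<Phi> Z P)"
proof -
  have Z': "Z \<in> Ob \<A>" using Z by (simp add: zero_object_def)
  have "(\<lambda>f. actA \<Phi> f (Idn \<M> P)) \<in> hom (HomG \<A> Z Z) (HomG \<M> (actO \<Phi> Z P) (actO \<Phi> Z P))"
    using eval_exact[OF P] Z' by (simp add: exact_functor_def additive_functor_def)
  from hom_one[OF this A.HomG_group[OF Z' Z'] M.HomG_group[OF act_Ob act_Ob]] show ?thesis
    using Z' P A.Idn_zero_object[OF Z] act_Idn[OF Z' P] by (simp add: HomG_def)
qed

lemma act_ten_zero_object:
  assumes "zero_object \<A> (X \<boxtimes>\<^bsub>\<A>\<^esub> Y)" "X \<in> Ob \<A>" "Y \<in> Ob \<A>" "P \<in> Ob \<M>"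
  defines "Z \<equiv> actO \<Phi> X (actO \<Phi> Y P)"
  shows "Idn \<M> Z = hzero \<M> Z Z"
  unfolding Z_def
  using M.Idn_zero_iso[OF act_zero_object[OF assms(1,4)] actm_iso[OF assms(2-4)]] .

text \<open>Evaluation at \<open>P\<close> gives a distinguished triangle with middle term
  \<open>\<one>(P)\<close>. The triple of an identity, \<open>act1 \<Phi> P\<close> and an identity
  is an isomorphism onto the triangle with middle term \<open>P\<close>, and it keeps the third
  arrow \<open>h\<close>.\<close>

lemma dist_eval:
  assumes d: "(\<epsilon>, \<eta>, \<delta>) \<in> dist \<A>" and e: "\<epsilon> \<in> Hom \<A> C (unit \<A>)" and n: "\<eta> \<in> Hom \<A> (unit \<A>) U"
    and P: "P \<in> Ob \<M>"
  shows "eval_to_unit \<M> \<Phi> \<epsilon> P \<in> Hom \<M> (actO \<Phi> C P) P"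
    "eval_from_unit \<M> \<Phi> \<eta> P \<in> Hom \<M> P (actO \<Phi> U P)"
    "\<exists>h. (eval_to_unit \<M> \<Phi> \<epsilon> P, eval_from_unit \<M> \<Phi> \<eta> P, h) \<in> dist \<M>"
proof -
  note I = M.Idn_Hom[OF P] and a = act1_iso[OF P]
  note ia = M.inv_arrow[OF a]
  have e': "actA \<Phi> \<epsilon> (Idn \<M> P) \<in> Hom \<M> (actO \<Phi> C P) (actO \<Phi> (unit \<A>) P)"
    and n': "actA \<Phi> \<eta> (Idn \<M> P) \<in> Hom \<M> (actO \<Phi> (unit \<A>) P) (actO \<Phi> U P)"
    using act_Hom[OF e I] act_Hom[OF n I] .
  show E: "eval_to_unit \<M> \<Phi> \<epsilon> P \<in> Hom \<M> (actO \<Phi> C P) P"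
    unfolding eval_to_unit_def by (rule M.Cmp_Hom[OF e' a(1)])
  show N: "eval_from_unit \<M> \<Phi> \<eta> P \<in> Hom \<M> P (actO \<Phi> U P)"
    unfolding eval_from_unit_def by (rule M.Cmp_Hom[OF ia(1) n'])
  have "\<exists>h. (actA \<Phi> \<epsilon> (Idn \<M> P), actA \<Phi> \<eta> (Idn \<M> P), h) \<in> dist \<M>"
    using eval_exact[OF P] d unfolding exact_functor_def by blast
  then obtain h where
    h: "(actA \<Phi> \<epsilon> (Idn \<M> P), actA \<Phi> \<eta> (Idn \<M> P), h) \<in> dist \<M>" by blast
  have h': "h \<in> Hom \<M> (actO \<Phi> U P) (shO \<M> (actO \<Phi> C P))"
    by (rule M.dist_Hom[OF h e' n'])
  have CP: "actO \<Phi> C P \<in> Ob \<M>" and UP: "actO \<Phi> U P \<in> Ob \<M>"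
    using M.HomD[OF E] M.HomD[OF N] by auto
  have "(eval_to_unit \<M> \<Phi> \<epsilon> P, eval_from_unit \<M> \<Phi> \<eta> P, h) \<in> dist \<M>"
  proof (rule M.dist_iso[OF h, where u = "Idn \<M> (actO \<Phi> C P)" and v = "act1 \<Phi> P"
        and w = "Idn \<M> (actO \<Phi> U P)"])
    show "triangle \<M> (eval_to_unit \<M> \<Phi> \<epsilon> P) (eval_from_unit \<M> \<Phi> \<eta> P) h"
      using M.HomD[OF E] M.HomD[OF N] M.HomD[OF h'] by (simp add: triangle_def)
    show "act1 \<Phi> P \<cdot>\<^bsub>\<M>\<^esub> actA \<Phi> \<epsilon> (Idn \<M> P)
        = eval_to_unit \<M> \<Phi> \<epsilon> P \<cdot>\<^bsub>\<M>\<^esub> Idn \<M> (actO \<Phi> C P)"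
      using M.Cmp_Idn[OF E] by (simp add: eval_to_unit_def)
    show "Idn \<M> (actO \<Phi> U P) \<cdot>\<^bsub>\<M>\<^esub> actA \<Phi> \<eta> (Idn \<M> P)
        = eval_from_unit \<M> \<Phi> \<eta> P \<cdot>\<^bsub>\<M>\<^esub> act1 \<Phi> P"
      unfolding eval_from_unit_def
      using M.Idn_Cmp[OF n'] M.Cmp_assoc[OF a(1) ia(1) n'] ia(2) M.Cmp_Idn[OF n'] by simp
    show "shA \<M> (Idn \<M> (actO \<Phi> C P)) \<cdot>\<^bsub>\<M>\<^esub> h = h \<cdot>\<^bsub>\<M>\<^esub> Idn \<M> (actO \<Phi> U P)"
      using M.shA_Idn[OF CP] M.Idn_Cmp[OF h'] M.Cmp_Idn[OF h'] by simp
  qed (use M.HomD[OF e'] M.HomD[OF n'] M.HomD[OF E] M.HomD[OF N] M.HomD[OF h'] a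
      M.Idn_Hom[OF CP] M.Idn_Hom[OF UP] M.iso_arrow_Idn[OF CP] M.iso_arrow_Idn[OF UP] in auto)
  then show "\<exists>h. (eval_to_unit \<M> \<Phi> \<epsilon> P, eval_from_unit \<M> \<Phi> \<eta> P, h) \<in> dist \<M>" by blast
qed

text \<open>Suspension is fully faithful and \<open>D(P[1])\<close> is isomorphic to
  \<open>D(P)[1]\<close>. Thus a shift of the target can be traded for a shift of
  \<open>P\<close>.\<close>

lemma suspend_act_bij:
  assumes "D \<in> Ob \<A>" "P \<in> Ob \<M>" "X \<in> Ob \<M>"
  shows "bij_betw (\<lambda>g. shA \<M> g \<cdot>\<^bsub>\<M>\<^esub> actsM \<Phi> D P) (Hom \<M> (actO \<Phi> D P) X)
    (Hom \<M> (actO \<Phi> D (shO \<M> P)) (shO \<M> X))"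
  using bij_betw_trans[OF M.shA_bij_Hom[OF act_Ob[OF assms(1,2)] assms(3)]
      M.precomp_iso_bij[OF actsM_iso[OF assms(1,2)]]]
  by (simp add: comp_def)

text \<open>Since \<open>sub\<close> holds for every \<open>P\<close>, shifting the target while
  shifting \<open>P\<close> along with it loses nothing. Having at most one element is used because
  it passes through mere bijections; a zero arrow then names that element.\<close>

lemma Hom_act_subsingleton_shift:
  assumes D: "D \<in> Ob \<A>" and X: "X \<in> Ob \<M>"
    and sub: "\<And>P f g. \<lbrakk>P \<in> Ob \<M>; f \<in> Hom \<M> (actO \<Phi> D P) X; g \<in> Hom \<M> (actO \<Phi> D P) X\<rbrakk>
      \<Longrightarrow> f = g"
    and P: "P \<in> Ob \<M>" and fg: "f \<in> Hom \<M> (actO \<Phi> D P) (shOp \<M> i X)"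
      "g \<in> Hom \<M> (actO \<Phi> D P) (shOp \<M> i X)"
  shows "f = g"
proof -
  \<comment> \<open>The quantifier over \<open>P\<close> belongs to the induction predicate, since
    each step replaces \<open>P\<close>. The shifted object is recorded as the domain of the shifted
    identity arrow.\<close>
  define Q where "Q e \<longleftrightarrow> (\<forall>P \<in> Ob \<M>. \<forall>f \<in> Hom \<M> (actO \<Phi> D P) (Dom \<M> e).
    \<forall>g \<in> Hom \<M> (actO \<Phi> D P) (Dom \<M> e). f = g)" for e
  have e: "Idn \<M> X \<in> Ar \<M>" using M.HomD[OF M.Idn_Hom[OF X]] by blast
  then have "Q (shAp \<M> i (Idn \<M> X))"
  proof (induction rule: M.shift_int_induct)
    case zero
    then show ?case using sub M.HomD[OF M.Idn_Hom[OF X]] unfolding Q_def by simp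
  next
    case (suspend e)
    have de: "Dom \<M> e \<in> Ob \<M>" "Dom \<M> (shA \<M> e) = shO \<M> (Dom \<M> e)"
      using M.Dom_Ob M.HomD[OF M.shA_Hom[OF M.ArHom]] suspend(1) by auto
    show ?case unfolding Q_def de(2)
    proof (intro ballI)
      fix P f g
      assume P: "P \<in> Ob \<M>" and fg: "f \<in> Hom \<M> (actO \<Phi> D P) (shO \<M> (Dom \<M> e))"
        "g \<in> Hom \<M> (actO \<Phi> D P) (shO \<M> (Dom \<M> e))"
      \<comment> \<open>The suspension is surjective on objects, so every \<open>P\<close> is itself
        a suspension and the hypothesis can be applied to \<open>R\<close>.\<close>
      obtain R where R: "R \<in> Ob \<M>" "P = shO \<M> R"
        using M.shO_bij P unfolding bij_betw_def by blast
      obtain f' g' where "f' \<in> Hom \<M> (actO \<Phi> D R) (Dom \<M> e)" "g' \<in> Hom \<M> (actO \<Phi> D R) (Dom \<M> e)"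
        "f = shA \<M> f' \<cdot>\<^bsub>\<M>\<^esub> actsM \<Phi> D R" "g = shA \<M> g' \<cdot>\<^bsub>\<M>\<^esub> actsM \<Phi> D R"
        using bij_betw_imp_surj_on[OF suspend_act_bij[OF D R(1) de(1)]] fg unfolding R(2) by blast
      then show "f = g" using suspend(2) R(1) unfolding Q_def by metis
    qed
  next
    case (desuspend e)
    have de: "Dom \<M> e \<in> Ob \<M>" "Dom \<M> (shA \<M> e) = shO \<M> (Dom \<M> e)"
      using M.Dom_Ob M.HomD[OF M.shA_Hom[OF M.ArHom]] desuspend(1) by auto
    show ?case unfolding Q_def
    proof (intro ballI)
      fix P f g
      assume P: "P \<in> Ob \<M>" and fg: "f \<in> Hom \<M> (actO \<Phi> D P) (Dom \<M> e)"
        "g \<in> Hom \<M> (actO \<Phi> D P) (Dom \<M> e)"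
      note b = suspend_act_bij[OF D P de(1)]
      have "shA \<M> f \<cdot>\<^bsub>\<M>\<^esub> actsM \<Phi> D P = shA \<M> g \<cdot>\<^bsub>\<M>\<^esub> actsM \<Phi> D P"
        using desuspend(2) M.shO_Ob[OF P] bij_betwE[OF b] fg unfolding Q_def de(2) by blast
      then show "f = g" using b fg unfolding bij_betw_def by (auto dest: inj_onD)
    qed
  qed
  then show ?thesis
    using P fg M.HomD[OF M.shAp_Hom[OF M.Idn_Hom[OF X]]] unfolding Q_def by auto
qed

text \<open>The bijections that trade the shift of the target for that of \<open>P\<close> form a
  commuting square with composition by \<open>e\<close> and by its suspension. So one of these
  compositions is bijective exactly when the other is.\<close>

lemma postcomp_act_bij_shift:
  assumes D: "D \<in> Ob \<A>" and e: "e \<in> Hom \<M> X Y"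
    and bij: "\<And>P. P \<in> Ob \<M> \<Longrightarrow>
      bij_betw (\<lambda>f. e \<cdot>\<^bsub>\<M>\<^esub> f) (Hom \<M> (actO \<Phi> D P) X) (Hom \<M> (actO \<Phi> D P) Y)"
    and P: "P \<in> Ob \<M>"
  shows "bij_betw (\<lambda>f. shAp \<M> i e \<cdot>\<^bsub>\<M>\<^esub> f) (Hom \<M> (actO \<Phi> D P) (shOp \<M> i X))
    (Hom \<M> (actO \<Phi> D P) (shOp \<M> i Y))"
proof -
  define B where "B P e \<longleftrightarrow> bij_betw (\<lambda>f. e \<cdot>\<^bsub>\<M>\<^esub> f) (Hom \<M> (actO \<Phi> D P) (Dom \<M> e))
    (Hom \<M> (actO \<Phi> D P) (Cod \<M> e))" for P e
  \<comment> \<open>An equivalence is proved, since the upward and the downward induction step use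
    opposite directions.\<close>
  have step: "B P e \<longleftrightarrow> B (shO \<M> P) (shA \<M> e)" if ar: "e \<in> Ar \<M>" and P: "P \<in> Ob \<M>" for P e
  proof -
    let ?T = "\<lambda>g. shA \<M> g \<cdot>\<^bsub>\<M>\<^esub> actsM \<Phi> D P"
    note e = M.ArHom[OF ar]
    note s = actsM_iso(1)[OF D P]
    note se = M.shA_Hom[OF e]
    have eq: "?T (e \<cdot>\<^bsub>\<M>\<^esub> g) = shA \<M> e \<cdot>\<^bsub>\<M>\<^esub> ?T g"
      if g: "g \<in> Hom \<M> (actO \<Phi> D P) (Dom \<M> e)" for g
      using M.shA_Cmp[OF g e] M.Cmp_assoc[OF s M.shA_Hom[OF g] se] by simp
    note T = suspend_act_bij[OF D P M.Dom_Ob[OF ar]] suspend_act_bij[OF D P M.Cod_Ob[OF ar]]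
    have "B P e \<longleftrightarrow> bij_betw (?T \<circ> (\<lambda>g. e \<cdot>\<^bsub>\<M>\<^esub> g)) (Hom \<M> (actO \<Phi> D P) (Dom \<M> e))
        (Hom \<M> (actO \<Phi> D (shO \<M> P)) (shO \<M> (Cod \<M> e)))"
      unfolding B_def by (rule bij_betw_comp_iff2[OF T(2)]) (use M.Cmp_Hom[OF _ e] in blast)
    also have "\<dots> \<longleftrightarrow> bij_betw ((\<lambda>g. shA \<M> e \<cdot>\<^bsub>\<M>\<^esub> g) \<circ> ?T)
        (Hom \<M> (actO \<Phi> D P) (Dom \<M> e))
        (Hom \<M> (actO \<Phi> D (shO \<M> P)) (shO \<M> (Cod \<M> e)))"
      by (rule bij_betw_cong) (simp add: eq)
    also have "\<dots> \<longleftrightarrow> B (shO \<M> P) (shA \<M> e)"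
      unfolding B_def M.HomD(2,3)[OF se] by (rule bij_betw_comp_iff[OF T(1), symmetric])
    finally show ?thesis .
  qed
  have "e \<in> Ar \<M>" using M.HomD[OF e] by blast
  then have "\<forall>P \<in> Ob \<M>. B P (shAp \<M> i e)"
  proof (induction rule: M.shift_int_induct)
    case zero
    then show ?case using bij M.HomD[OF e] unfolding B_def by simp
  next
    case (suspend e)
    show ?case
    proof
      fix P assume "P \<in> Ob \<M>"
      then obtain R where "R \<in> Ob \<M>" "P = shO \<M> R"
        using M.shO_bij unfolding bij_betw_def by blast
      then show "B P (shA \<M> e)" using suspend step by blast
    qed
  next
    case (desuspend e)
    then show ?case using step M.shO_Ob by blast
  qed
  then show ?thesis using P M.HomD[OF M.shAp_Hom[OF e]] unfolding B_def by auto
qed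

end

section \<open>Orthogonality and its consequences for a pair of complementary idempotents\<close>

locale complementary_idempotents_action = triangulated_action \<A> \<M> \<Phi>
  for \<A> :: "('o, 'a, 'x) tm_category_scheme"
    and \<M> :: "('p, 'b, 'y) tri_category_scheme"
    and \<Phi> :: "('o, 'a, 'p, 'b, 'z) action_scheme" +
  fixes C U :: 'o and \<epsilon> \<eta> \<delta> :: 'a
  assumes ci: "complementary_idempotents \<A> C U \<epsilon> \<eta> \<delta>"
begin

lemma C_Ob: "C \<in> Ob \<A>" and U_Ob: "U \<in> Ob \<A>"
  and eps_Hom: "\<epsilon> \<in> Hom \<A> C (unit \<A>)" and eta_Hom: "\<eta> \<in> Hom \<A> (unit \<A>) U"
  and idempotent_dist: "(\<epsilon>, \<eta>, \<delta>) \<in> dist \<A>"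
  and CU_zero: "zero_object \<A> (C \<boxtimes>\<^bsub>\<A>\<^esub> U)" and UC_zero: "zero_object \<A> (U \<boxtimes>\<^bsub>\<A>\<^esub> C)"
  using ci unfolding complementary_idempotents_def by auto

text \<open>By naturality, \<open>\<eta>\<close> at \<open>U(Q)\<close> composed with \<open>f\<close> factors through \<open>U(C(P)) \<cong> 0\<close>;
  hence \<open>f\<close> itself factors through \<open>C(U(Q)) \<cong> 0\<close>.\<close>

lemma Hom_C_U_zero:
  assumes P: "P \<in> Ob \<M>" and Q: "Q \<in> Ob \<M>" and f: "f \<in> Hom \<M> (actO \<Phi> C P) (actO \<Phi> U Q)"
  shows "f = hzero \<M> (actO \<Phi> C P) (actO \<Phi> U Q)"
proof -
  let ?CP = "actO \<Phi> C P" and ?UQ = "actO \<Phi> U Q" and ?I = "unit \<A>"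
  let ?F = "actA \<Phi> (Idn \<A> ?I) f"
  have CP: "?CP \<in> Ob \<M>" and UQ: "?UQ \<in> Ob \<M>"
    using act_Ob C_Ob U_Ob P Q by auto
  note I = A.Idn_Hom[OF A.unit_Ob]
  have F: "?F \<in> Hom \<M> (actO \<Phi> ?I ?CP) (actO \<Phi> ?I ?UQ)" by (rule act_Hom[OF I f])
  have eta: "actA \<Phi> \<eta> (Idn \<M> R) \<in> Hom \<M> (actO \<Phi> ?I R) (actO \<Phi> U R)"
    and eps: "actA \<Phi> \<epsilon> (Idn \<M> R) \<in> Hom \<M> (actO \<Phi> C R) (actO \<Phi> ?I R)" if "R \<in> Ob \<M>" for R
    using act_Hom[OF eta_Hom M.Idn_Hom] act_Hom[OF eps_Hom M.Idn_Hom] that by auto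
  have Uf: "actA \<Phi> (Idn \<A> U) f \<in> Hom \<M> (actO \<Phi> U ?CP) (actO \<Phi> U ?UQ)"
    by (rule act_Hom[OF A.Idn_Hom[OF U_Ob] f])
  have "actA \<Phi> \<eta> (Idn \<M> ?UQ) \<cdot>\<^bsub>\<M>\<^esub> ?F = actA \<Phi> (Idn \<A> U) f \<cdot>\<^bsub>\<M>\<^esub> actA \<Phi> \<eta> (Idn \<M> ?CP)"
    by (rule act_interchange[OF eta_Hom f])
  also have "\<dots> = hzero \<M> (actO \<Phi> ?I ?CP) (actO \<Phi> U ?UQ)"
    using M.Hom_into_zero[OF act_ten_zero_object[OF UC_zero U_Ob C_Ob P] eta[OF CP]]
      M.Cmp_zero[OF Uf] M.HomD[OF F] by simp
  finally have *: "actA \<Phi> \<eta> (Idn \<M> ?UQ) \<cdot>\<^bsub>\<M>\<^esub> ?F = hzero \<M> (actO \<Phi> ?I ?CP) (actO \<Phi> U ?UQ)" .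
  obtain h where d: "(actA \<Phi> \<epsilon> (Idn \<M> ?UQ), actA \<Phi> \<eta> (Idn \<M> ?UQ), h) \<in> dist \<M>"
    using eval_exact[OF UQ] idempotent_dist unfolding exact_functor_def by blast
  obtain v where v: "v \<in> Hom \<M> (actO \<Phi> ?I ?CP) (actO \<Phi> C ?UQ)"
    "actA \<Phi> \<epsilon> (Idn \<M> ?UQ) \<cdot>\<^bsub>\<M>\<^esub> v = ?F"
    using M.dist_weak_kernel[OF d eps[OF UQ] eta[OF UQ] F *] by blast
  have "?F = hzero \<M> (actO \<Phi> ?I ?CP) (actO \<Phi> ?I ?UQ)"
    using v(2) M.Hom_into_zero[OF act_ten_zero_object[OF CU_zero C_Ob U_Ob Q] v(1)]
      M.Cmp_zero[OF eps[OF UQ]] M.HomD[OF F] by simp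
  \<comment> \<open>What has been shown to vanish is \<open>\<one>(f)\<close>; naturality of the
    unit isomorphism transfers this to \<open>f\<close>.\<close>
  moreover have "act1 \<Phi> ?UQ \<cdot>\<^bsub>\<M>\<^esub> ?F = f \<cdot>\<^bsub>\<M>\<^esub> act1 \<Phi> ?CP"
    using act1_natural M.HomD[OF f] by (auto simp: natural_iso_def)
  ultimately have "f \<cdot>\<^bsub>\<M>\<^esub> act1 \<Phi> ?CP = hzero \<M> (actO \<Phi> ?I ?CP) ?UQ"
    using M.Cmp_zero[OF act1_iso(1)[OF UQ]] M.HomD[OF F] by metis
  then show ?thesis
    by (rule M.zero_Cmp_iso[OF act1_iso[OF CP] f])
qed

lemma Hom_C_shift_U_zero:
  assumes P: "P \<in> Ob \<M>" and Q: "Q \<in> Ob \<M>"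
    and f: "f \<in> Hom \<M> (actO \<Phi> C P) (shOp \<M> i (actO \<Phi> U Q))"
  shows "f = hzero \<M> (actO \<Phi> C P) (shOp \<M> i (actO \<Phi> U Q))"
  by (rule Hom_act_subsingleton_shift[OF C_Ob act_Ob[OF U_Ob Q] _ P f])
    (use Hom_C_U_zero Q M.hzero_Hom M.HomD[OF f] in \<open>metis, auto\<close>)

text \<open>As \<open>C(P)[1]\<close> is isomorphic to \<open>C(P[1])\<close>, vanishing on objects
  of the form \<open>C(R)\<close> also covers their suspensions, which occur as the fourth term of
  the triangle.\<close>

lemma Hom_suspend_C_zero:
  assumes P: "P \<in> Ob \<M>"
    and X: "\<And>g. g \<in> Hom \<M> (actO \<Phi> C (shO \<M> P)) X \<Longrightarrow> g = hzero \<M> (actO \<Phi> C (shO \<M> P)) X"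
    and f: "f \<in> Hom \<M> (shO \<M> (actO \<Phi> C P)) X"
  shows "f = hzero \<M> (shO \<M> (actO \<Phi> C P)) X"
  using M.zero_Cmp_iso[OF actsM_iso[OF C_Ob P] f] X M.Cmp_Hom[OF actsM_iso(1)[OF C_Ob P] f]
  by blast

text \<open>Apply \<open>Hom(-, X)\<close> to \<open>C(P) -> P -> U(P) -> C(P)[1]\<close>. The
  kernel comes from \<open>Hom(C(P)[1], X)\<close> and the obstruction to surjectivity lies in
  \<open>Hom(C(P), X)\<close>; both vanish. The object \<open>X\<close> is left general so that
  every shift of \<open>U(Q)\<close> is allowed.\<close>

lemma precomp_eta_bij:
  assumes P: "P \<in> Ob \<M>" and X: "X \<in> Ob \<M>"
    and zero: "\<And>R g. \<lbrakk>R \<in> Ob \<M>; g \<in> Hom \<M> (actO \<Phi> C R) X\<rbrakk> \<Longrightarrow> g = hzero \<M> (actO \<Phi> C R) X"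
  shows "bij_betw (\<lambda>g. g \<cdot>\<^bsub>\<M>\<^esub> eval_from_unit \<M> \<Phi> \<eta> P) (Hom \<M> (actO \<Phi> U P) X) (Hom \<M> P X)"
proof -
  let ?e = "eval_to_unit \<M> \<Phi> \<epsilon> P" and ?n = "eval_from_unit \<M> \<Phi> \<eta> P"
  note ev = dist_eval[OF idempotent_dist eps_Hom eta_Hom P]
  obtain h where d: "(?e, ?n, h) \<in> dist \<M>" using ev(3) by blast
  note h = M.dist_Hom[OF d ev(1,2)]
  have "inj_on (\<lambda>g. g \<cdot>\<^bsub>\<M>\<^esub> ?n) (Hom \<M> (actO \<Phi> U P) X)"
  proof (rule M.precomp_injI[OF ev(2) X])
    fix g assume g: "g \<in> Hom \<M> (actO \<Phi> U P) X" "g \<cdot>\<^bsub>\<M>\<^esub> ?n = hzero \<M> P X"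
    \<comment> \<open>After one rotation \<open>g\<close> kills the first arrow of
      \<open>P -> U(P) -> C(P)[1]\<close>, so it factors through \<open>h\<close>.\<close>
    obtain v where v: "v \<in> Hom \<M> (shO \<M> (actO \<Phi> C P)) X" "v \<cdot>\<^bsub>\<M>\<^esub> h = g"
      using M.dist_weak_cokernel[OF M.dist_rotateD[OF d] ev(2) h g] by blast
    have "v = hzero \<M> (shO \<M> (actO \<Phi> C P)) X"
      by (rule Hom_suspend_C_zero[OF P zero[OF M.shO_Ob[OF P]] v(1)])
    then show "g = hzero \<M> (actO \<Phi> U P) X"
      using v(2) M.zero_Cmp[OF h X] by simp
  qed
  moreover have "(\<lambda>g. g \<cdot>\<^bsub>\<M>\<^esub> ?n) ` Hom \<M> (actO \<Phi> U P) X = Hom \<M> P X"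
  proof (intro equalityI subsetI)
    fix u assume u: "u \<in> Hom \<M> P X"
    then show "u \<in> (\<lambda>g. g \<cdot>\<^bsub>\<M>\<^esub> ?n) ` Hom \<M> (actO \<Phi> U P) X"
      using M.dist_weak_cokernel[OF d ev(1,2) u zero[OF P M.Cmp_Hom[OF ev(1) u]]] by blast
  qed (use M.Cmp_Hom[OF ev(2)] in blast)
  ultimately show ?thesis unfolding bij_betw_def ..
qed

text \<open>Apply \<open>Hom(C(P), -)\<close> to \<open>C(Q) -> Q -> U(Q)\<close>. Surjectivity
  follows from the vanishing of \<open>Hom(C(P), U(Q))\<close>. The kernel comes from maps into the
  desuspension of \<open>U(Q)\<close>; suspending a kernel element turns these into maps from
  \<open>C(P)[1]\<close> to \<open>U(Q)\<close>, which vanish as well.\<close>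

lemma postcomp_eps_bij:
  assumes P: "P \<in> Ob \<M>" and Q: "Q \<in> Ob \<M>"
  shows "bij_betw (\<lambda>g. eval_to_unit \<M> \<Phi> \<epsilon> Q \<cdot>\<^bsub>\<M>\<^esub> g)
    (Hom \<M> (actO \<Phi> C P) (actO \<Phi> C Q)) (Hom \<M> (actO \<Phi> C P) Q)"
proof -
  let ?e = "eval_to_unit \<M> \<Phi> \<epsilon> Q" and ?n = "eval_from_unit \<M> \<Phi> \<eta> Q"
  let ?CP = "actO \<Phi> C P" and ?CQ = "actO \<Phi> C Q"
  note ev = dist_eval[OF idempotent_dist eps_Hom eta_Hom Q]
  obtain h where d: "(?e, ?n, h) \<in> dist \<M>" using ev(3) by blast
  note h = M.dist_Hom[OF d ev(1,2)]
  have CP: "?CP \<in> Ob \<M>" and CQ: "?CQ \<in> Ob \<M>" using act_Ob C_Ob P Q by auto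
  have "inj_on (\<lambda>g. ?e \<cdot>\<^bsub>\<M>\<^esub> g) (Hom \<M> ?CP ?CQ)"
  proof (rule M.postcomp_injI[OF ev(1) CP])
    fix g assume g: "g \<in> Hom \<M> ?CP ?CQ" "?e \<cdot>\<^bsub>\<M>\<^esub> g = hzero \<M> ?CP Q"
    note sg = M.shA_Hom[OF g(1)] and se = M.shA_Hom[OF ev(1)]
    \<comment> \<open>The sign is that of the triangle rotated twice,
      \<open>U(Q) -> C(Q)[1] -> Q[1]\<close>, whose second arrow is minus the suspension of
      \<open>?e\<close>. Hence the suspension of \<open>g\<close> factors through
      \<open>h\<close>.\<close>
    have "hneg \<M> (shA \<M> ?e) \<cdot>\<^bsub>\<M>\<^esub> shA \<M> g = hzero \<M> (shO \<M> ?CP) (shO \<M> Q)"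
      using M.hneg_Cmp[OF sg se] M.shA_Cmp[OF g(1) ev(1)] g(2) M.shA_zero[OF CP Q]
        M.hneg_zero[OF M.shO_Ob[OF CP] M.shO_Ob[OF Q]] by metis
    then obtain v where v: "v \<in> Hom \<M> (shO \<M> ?CP) (actO \<Phi> U Q)" "h \<cdot>\<^bsub>\<M>\<^esub> v = shA \<M> g"
      using M.dist_weak_kernel[OF M.dist_rotateD[OF M.dist_rotateD[OF d]] h M.hneg_Hom[OF se] sg]
      by blast
    have "v = hzero \<M> (shO \<M> ?CP) (actO \<Phi> U Q)"
      by (rule Hom_suspend_C_zero[OF P Hom_C_U_zero[OF M.shO_Ob[OF P] Q] v(1)])
    then have "shA \<M> g = shA \<M> (hzero \<M> ?CP ?CQ)"
      using v(2) M.Cmp_zero[OF h M.shO_Ob[OF CP]] M.shA_zero[OF CP CQ] by simp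
    then show "g = hzero \<M> ?CP ?CQ"
      using M.shA_bij_Hom[OF CP CQ] g(1) M.hzero_Hom[OF CP CQ]
      unfolding bij_betw_def by (auto dest: inj_onD)
  qed
  moreover have "(\<lambda>g. ?e \<cdot>\<^bsub>\<M>\<^esub> g) ` Hom \<M> ?CP ?CQ = Hom \<M> ?CP Q"
  proof (intro equalityI subsetI)
    fix u assume u: "u \<in> Hom \<M> ?CP Q"
    then show "u \<in> (\<lambda>g. ?e \<cdot>\<^bsub>\<M>\<^esub> g) ` Hom \<M> ?CP ?CQ"
      using M.dist_weak_kernel[OF d ev(1,2) u Hom_C_U_zero[OF P Q M.Cmp_Hom[OF u ev(2)]]] by blast
  qed (use M.Cmp_Hom[OF _ ev(1)] in blast)
  ultimately show ?thesis unfolding bij_betw_def ..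
qed

section \<open>The three graded statements\<close>

lemma grHom_C_U_trivial:
  assumes "P \<in> Ob \<M>" "Q \<in> Ob \<M>"
  shows "trivial_group (grHom \<M> (actO \<Phi> C P) (actO \<Phi> U Q))"
  using M.grHom_trivial[OF act_Ob[OF C_Ob assms(1)] act_Ob[OF U_Ob assms(2)]]
    Hom_C_shift_U_zero[OF assms] by blast

text \<open>In degree \<open>i\<close> the bijection is \<open>precomp_eta_bij\<close> with
  \<open>X\<close> taken to be \<open>U(Q)[i]\<close>, which receives only zero arrows from objects
  \<open>C(R)\<close>.\<close>

lemma gr_precomp_eta_iso:
  assumes P: "P \<in> Ob \<M>" and Q: "Q \<in> Ob \<M>"
  shows "gr_precomp \<M> (eval_from_unit \<M> \<Phi> \<eta> P)
    \<in> iso (grHom \<M> (actO \<Phi> U P) (actO \<Phi> U Q)) (grHom \<M> P (actO \<Phi> U Q))"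
  by (intro M.gr_precomp_iso[OF dist_eval(2)[OF idempotent_dist eps_Hom eta_Hom P]]
      precomp_eta_bij P Hom_C_shift_U_zero Q M.shOp_Ob act_Ob U_Ob)

text \<open>Here the composing arrow is shifted along with the degree, so the bijection of degree
  \<open>0\<close>, known for all \<open>P\<close>, is transported to the other degrees.\<close>

lemma gr_postcomp_eps_iso:
  assumes P: "P \<in> Ob \<M>" and Q: "Q \<in> Ob \<M>"
  shows "gr_postcomp \<M> (eval_to_unit \<M> \<Phi> \<epsilon> Q)
    \<in> iso (grHom \<M> (actO \<Phi> C P) (actO \<Phi> C Q)) (grHom \<M> (actO \<Phi> C P) Q)"
proof -
  note e = dist_eval(1)[OF idempotent_dist eps_Hom eta_Hom Q]
  show ?thesis
    by (rule M.gr_postcomp_iso[OF e act_Ob[OF C_Ob P]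
        postcomp_act_bij_shift[OF C_Ob e postcomp_eps_bij[OF _ Q] P]])
qed

end

theorem theorem1p2:
  fixes \<A> :: "('o, 'a) tm_category"
    and \<M> :: "('p, 'b) tri_category"
    and \<Phi> :: "('o, 'a, 'p, 'b) action"
    and C U :: 'o and \<epsilon> \<eta> \<delta> :: 'a and M N :: 'p
  assumes "triangulated_monoidal_category \<A>"
    and "triangulated_category \<M>"
    and "triangulated_action \<A> \<M> \<Phi>"
    and "complementary_idempotents \<A> C U \<epsilon> \<eta> \<delta>"
    and "M \<in> Ob \<M>" and "N \<in> Ob \<M>"
  shows "grHom \<M> (actO \<Phi> U M) (actO \<Phi> U N) \<cong> grHom \<M> M (actO \<Phi> U N) \<and>
         grHom \<M> (actO \<Phi> C M) (actO \<Phi> C N) \<cong> grHom \<M> (actO \<Phi> C M) N \<and>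
         trivial_group (grHom \<M> (actO \<Phi> C M) (actO \<Phi> U N)) \<and>
         gr_precomp \<M> (eval_from_unit \<M> \<Phi> \<eta> M)
           \<in> iso (grHom \<M> (actO \<Phi> U M) (actO \<Phi> U N)) (grHom \<M> M (actO \<Phi> U N)) \<and>
         gr_postcomp \<M> (eval_to_unit \<M> \<Phi> \<epsilon> N)
           \<in> iso (grHom \<M> (actO \<Phi> C M) (actO \<Phi> C N)) (grHom \<M> (actO \<Phi> C M) N)"
proof -
  interpret complementary_idempotents_action \<A> \<M> \<Phi> C U \<epsilon> \<eta> \<delta>
    using assms by (simp add: complementary_idempotents_action_def
        complementary_idempotents_action_axioms_def)
  note iso = gr_precomp_eta_iso[OF assms(5,6)] gr_postcomp_eps_iso[OF assms(5,6)]
  show ?thesis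
    using iso grHom_C_U_trivial[OF assms(5,6)] is_isoI[OF iso(1)] is_isoI[OF iso(2)] by blast
qed

end
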